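(* Let $\Omega\subset\mathbb{R}^n$ be a nonempty open set. Let $u\in W^{1,p(\cdot)}(\Omega)$ and $u_1,u_2\in W^{1,p(\cdot)}_0(\Omega)$ be such that $u_1\le u\le u_2$ a.e. in $\Omega$. Then $u\in W^{1,p(\cdot)}_0(\Omega)$.
   Context: Standing assumptions: $p:\mathbb{R}^n\to[1,\infty]$ is measurable, $1<p^-:=\operatorname{ess\,inf}_{\mathbb{R}^n}p\le p^+:=\operatorname{ess\,sup}_{\mathbb{R}^n}p<\infty$, and $p$ is log-H\"older continuous: there is $L>0$ with $|p(x)-p(y)|\le L/\log(e+1/|x-y|)$ for all $x,y\in\mathbb{R}^n$. For an open set $\Omega$, $L^{p(\cdot)}(\Omega)$ is the space of measurable $u:\Omega\to\mathbb{R}$ with finite norm $\|u\|_{L^{p(\cdot)}(\Omega)}=\inf\{\lambda>0:\int_\Omega|u(x)/\lambda|^{p(x)}\,dx\le1\}$; $W^{1,p(\cdot)}(\Omega)$ consists of $u\in L^{p(\cdot)}(\Omega)$ with distributional gradient $\nabla u\in L^{p(\cdot)}(\Omega)$, with norm $\|u\|_{L^{p(\cdot)}(\Omega)}+\|\nabla u\|_{L^{p(\cdot)}(\Omega)}$. $W^{1,p(\cdot)}_0(\Omega)$ is the closure in $W^{1,p(\cdot)}(\Omega)$ of the $W^{1,p(\cdot)}(\mathbb{R}^n)$-functions with compact support in $\Omega$. *)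

theory Defs
  imports "HOL-Analysis.Analysis" "HOL-Probability.Essential_Supremum"
begin

subsection \<open>Variable exponents\<close>

definition essinf :: "'a measure \<Rightarrow> ('a \<Rightarrow> ereal) \<Rightarrow> ereal" where
  "essinf M f = Sup {z. AE x in M. z \<le> f x}"

text \<open>On the diagonal Isabelle evaluates \<open>1 / 0\<close> to \<open>0\<close>; the inequality then only requires
  \<open>\<bar>p x - p x\<bar> \<le> L\<close>, which is trivial where \<open>p x\<close> is finite. Infinite values
  are excluded, as \<open>\<infinity> - \<infinity> = \<infinity>\<close> in \<^typ>\<open>ereal\<close>; for exponents with finite
  essential supremum the inequality off the diagonal excludes them anyway.\<close>

definition log_Hoelder :: "('a::euclidean_space \<Rightarrow> ereal) \<Rightarrow> bool" where
  "log_Hoelder p \<longleftrightarrow>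
     (\<exists>L>0. \<forall>x y. \<bar>p x - p y\<bar> \<le> ereal (L / ln (exp 1 + 1 / norm (x - y))))"

definition admissible_exponent :: "('a::euclidean_space \<Rightarrow> ereal) \<Rightarrow> bool" where
  "admissible_exponent p \<longleftrightarrow>
     p \<in> borel_measurable lebesgue \<and> (\<forall>x. 1 \<le> p x) \<and>
     1 < essinf lebesgue p \<and> esssup lebesgue p < \<infinity> \<and> log_Hoelder p"

subsection \<open>Variable exponent Lebesgue spaces\<close>

text \<open>Functions on \<open>\<Omega>\<close> are total functions of which only the values on \<open>\<Omega>\<close> matter, and
  elements of the function spaces are represented by functions rather than by classes modulo
  null sets. The coercion \<^const>\<open>real_of_ereal\<close> is harmless, since admissible exponents
  are finite. The norm is \<open>\<infinity>\<close> if no \<open>t\<close> is admissible in the infimum. The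
  range type is general in order to cover gradients.\<close>

definition Lp_norm ::
    "('a::euclidean_space \<Rightarrow> ereal) \<Rightarrow> 'a set \<Rightarrow> ('a \<Rightarrow> 'b::euclidean_space) \<Rightarrow> ennreal" where
  "Lp_norm p \<Omega> u =
     (INF t\<in>{t::real. t > 0 \<and>
        (\<integral>\<^sup>+x\<in>\<Omega>. ennreal ((norm (u x) / t) powr real_of_ereal (p x)) \<partial>lebesgue) \<le> 1}.
      ennreal t)"

definition Lp_space ::
    "('a::euclidean_space \<Rightarrow> ereal) \<Rightarrow> 'a set \<Rightarrow> ('a \<Rightarrow> 'b::euclidean_space) set" where
  "Lp_space p \<Omega> = {u. u \<in> borel_measurable (lebesgue_on \<Omega>) \<and> Lp_norm p \<Omega> u < \<infinity>}"

subsection \<open>Distributional gradients\<close>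

primrec Ck :: "nat \<Rightarrow> ('a::euclidean_space \<Rightarrow> real) \<Rightarrow> bool" where
  "Ck 0 f \<longleftrightarrow> continuous_on UNIV f"
| "Ck (Suc k) f \<longleftrightarrow>
     (\<forall>x. f differentiable (at x)) \<and>
     (\<forall>i\<in>Basis. Ck k (\<lambda>x. frechet_derivative f (at x) i))"

definition compact_support_in ::
    "('a::euclidean_space \<Rightarrow> real) \<Rightarrow> 'a set \<Rightarrow> bool" where
  "compact_support_in f \<Omega> \<longleftrightarrow>
     compact (closure {x. f x \<noteq> 0}) \<and> closure {x. f x \<noteq> 0} \<subseteq> \<Omega>"

definition test_functions :: "'a::euclidean_space set \<Rightarrow> ('a \<Rightarrow> real) set" where
  "test_functions \<Omega> = {\<phi>. (\<forall>k. Ck k \<phi>) \<and> compact_support_in \<phi> \<Omega>}"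

definition locally_integrable ::
    "'a::euclidean_space set \<Rightarrow> ('a \<Rightarrow> 'b::euclidean_space) \<Rightarrow> bool" where
  "locally_integrable \<Omega> f \<longleftrightarrow> (\<forall>K. compact K \<and> K \<subseteq> \<Omega> \<longrightarrow> set_integrable lebesgue K f)"

definition is_weak_gradient ::
    "'a::euclidean_space set \<Rightarrow> ('a \<Rightarrow> real) \<Rightarrow> ('a \<Rightarrow> 'a) \<Rightarrow> bool" where
  "is_weak_gradient \<Omega> u g \<longleftrightarrow>
     locally_integrable \<Omega> u \<and> locally_integrable \<Omega> g \<and>
     (\<forall>\<phi>\<in>test_functions \<Omega>. \<forall>i\<in>Basis.
        (LINT x:\<Omega>|lebesgue. u x * frechet_derivative \<phi> (at x) i)
        = - (LINT x:\<Omega>|lebesgue. (g x \<bullet> i) * \<phi> x))"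

text \<open>The weak gradient is unique only up to a null set; all uses below are invariant under
  modification on a null set.\<close>

definition weak_gradient ::
    "'a::euclidean_space set \<Rightarrow> ('a \<Rightarrow> real) \<Rightarrow> ('a \<Rightarrow> 'a)" where
  "weak_gradient \<Omega> u = (SOME g. is_weak_gradient \<Omega> u g)"

subsection \<open>Variable exponent Sobolev spaces\<close>

definition W1p ::
    "('a::euclidean_space \<Rightarrow> ereal) \<Rightarrow> 'a set \<Rightarrow> ('a \<Rightarrow> real) set" where
  "W1p p \<Omega> = {u. u \<in> Lp_space p \<Omega> \<and> (\<exists>g. is_weak_gradient \<Omega> u g \<and> g \<in> Lp_space p \<Omega>)}"

definition W1p_norm ::
    "('a::euclidean_space \<Rightarrow> ereal) \<Rightarrow> 'a set \<Rightarrow> ('a \<Rightarrow> real) \<Rightarrow> ennreal" where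
  "W1p_norm p \<Omega> u = Lp_norm p \<Omega> u + Lp_norm p \<Omega> (weak_gradient \<Omega> u)"

text \<open>The support condition is on the representative \<open>v\<close>. A function which vanishes almost
  everywhere off a compact subset of \<open>\<Omega>\<close> has a representative satisfying it, so the
  closure is the same as the one formed with essential supports.\<close>

definition W1p_0 ::
    "('a::euclidean_space \<Rightarrow> ereal) \<Rightarrow> 'a set \<Rightarrow> ('a \<Rightarrow> real) set" where
  "W1p_0 p \<Omega> =
     {u \<in> W1p p \<Omega>. \<forall>\<epsilon>>0. \<exists>v\<in>W1p p UNIV.
        compact_support_in v \<Omega> \<and> W1p_norm p \<Omega> (\<lambda>x. u x - v x) < ennreal \<epsilon>}"

end

theory Submission
  imports Defs
begin

text \<open>Subtracting \<open>u\<^sub>1\<close>, let \<open>w = u - u\<^sub>1\<close>, so that \<open>0 \<le> w \<le> u\<^sub>2 - u\<^sub>1\<close>. If \<open>z\<close> has compact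
  support in \<open>\<Omega>\<close> and is close to \<open>u\<^sub>2 - u\<^sub>1\<close>, then \<open>min w z = w - max 0 (w - z)\<close> has compact
  support too, and its distance to \<open>w\<close> is the norm of the positive part of \<open>w - z\<close>, a small
  perturbation of \<open>a = u - u\<^sub>2 \<le> 0\<close>. The gradient of that positive part is
  \<open>\<nabla>(w - z)\<close> restricted to \<open>{w > z}\<close>; up to a small error this is \<open>\<nabla>a\<close> on \<open>{w > z}\<close>, which tends
  to \<open>0\<close> in the modular by dominated convergence, as \<open>\<nabla>a = 0\<close> almost everywhere on
  \<open>{a = 0}\<close>. The chain rule for the positive part is obtained without mollification: difference
  quotients of an integrable weakly differentiable function converge locally in \<open>L\<^sup>1\<close> to the weak
  derivative, and the difference quotients of the positive part have a pointwise limit.\<close>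

text \<open>Since the exponent is essentially bounded, smallness in norm and smallness in the
  modular are equivalent; the modular is an integral and so accessible to dominated convergence. The
  obstacle is the set \<open>{w > z}\<close>: smallness of \<open>w - z - a\<close> says nothing
  about its size inside \<open>{a = 0}\<close>, where it may stay large for every z. Pointwise
  convergence settles \<open>{a < 0}\<close>, and only the vanishing of the gradient settles
  \<open>{a = 0}\<close>. As \<open>u1\<close> itself is only a limit of compactly supported
  functions, z is \<open>v2 - v1\<close> with approximants of \<open>u2\<close> and
  \<open>u1\<close>, and the approximant of u is \<open>v1 + min (u - u1) (v2 - v1)\<close>. The
  chain rule is a pure L1 matter. The distance between a difference quotient of f and the weak
  derivative g is measured by duality, with tests between 0 and 1: there the derivative falls on the
  test function, and continuity of translations of g in L1 makes the pairing small.\<close>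

subsection \<open>Smooth functions\<close>

lemma CkD_Suc:
  assumes "Ck (Suc k) f"
  shows "(f has_derivative frechet_derivative f (at x)) (at x)"
    and "i \<in> Basis \<Longrightarrow> Ck k (\<lambda>x. frechet_derivative f (at x) i)"
  using assms by (auto simp: frechet_derivative_works)

lemma Ck_SucI:
  assumes "\<And>x. (f has_derivative f' x) (at x)" "\<And>i. i \<in> Basis \<Longrightarrow> Ck k (\<lambda>x. f' x i)"
  shows "Ck (Suc k) f"
proof -
  have "f' = (\<lambda>x. frechet_derivative f (at x))"
    using assms(1) frechet_derivative_at by blast
  then show ?thesis
    using assms by (auto simp: differentiable_def)
qed

text \<open>\<open>Ck (Suc k)\<close> does not ask for continuity of f itself; differentiability
  supplies it in the base case. The product and chain rules need this because undifferentiated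
  factors remain in them.\<close>

lemma Ck_lower: "Ck (Suc k) f \<Longrightarrow> Ck k f"
proof (induction k arbitrary: f)
  case 0
  then have "\<And>x. f differentiable (at x)" by simp
  then show ?case
    by (auto intro!: continuous_at_imp_continuous_on differentiable_imp_continuous_within)
next
  case (Suc k)
  then show ?case by (metis Ck.simps(2))
qed

lemma Ck_const: "Ck k (\<lambda>x. c)"
proof (induction k arbitrary: c)
  case (Suc k)
  show ?case by (rule Ck_SucI[of _ "\<lambda>_ _. 0"]) (auto intro: Suc)
qed auto

lemma Ck_bounded_linear:
  assumes "bounded_linear f" shows "Ck k f"
proof (cases k)
  case 0
  then show ?thesis using assms by (simp add: linear_continuous_on)
next
  case (Suc m)
  show ?thesis unfolding Suc
    by (rule Ck_SucI[of _ "\<lambda>_. f"])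
       (auto intro!: Ck_const bounded_linear_imp_has_derivative assms)
qed

lemma Ck_add: "Ck k f \<Longrightarrow> Ck k g \<Longrightarrow> Ck k (\<lambda>x. f x + g x)"
proof (induction k arbitrary: f g)
  case 0
  then show ?case by (auto intro: continuous_on_add)
next
  case (Suc k)
  show ?case
    by (rule Ck_SucI[OF has_derivative_add[OF CkD_Suc(1) CkD_Suc(1)]])
      (use Suc.IH Suc.prems CkD_Suc(2)[OF Suc.prems(1)] CkD_Suc(2)[OF Suc.prems(2)] in auto)
qed

lemma Ck_mult: "Ck k f \<Longrightarrow> Ck k g \<Longrightarrow> Ck k (\<lambda>x. f x * g x)"
proof (induction k arbitrary: f g)
  case 0
  then show ?case by (auto intro: continuous_on_mult)
next
  case (Suc k)
  show ?case
  proof (rule Ck_SucI[OF has_derivative_mult[OF CkD_Suc(1) CkD_Suc(1)]])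
    fix i :: 'a assume "i \<in> Basis"
    then show "Ck k (\<lambda>x. f x * frechet_derivative g (at x) i + frechet_derivative f (at x) i * g x)"
      by (intro Ck_add Suc.IH Ck_lower[OF Suc.prems(1)] Ck_lower[OF Suc.prems(2)]
            CkD_Suc(2)[OF Suc.prems(1)] CkD_Suc(2)[OF Suc.prems(2)])
  qed (use Suc in auto)
qed

lemma Ck_cmult: "Ck k f \<Longrightarrow> Ck k (\<lambda>x. c * f x)"
  by (rule Ck_mult[OF Ck_const])

lemma Ck_diff: "Ck k f \<Longrightarrow> Ck k g \<Longrightarrow> Ck k (\<lambda>x. f x - g x)"
  using Ck_add[OF _ Ck_cmult[of k g "-1"]] by simp

lemma Ck_prod: "(\<And>i. i \<in> I \<Longrightarrow> Ck k (f i)) \<Longrightarrow> Ck k (\<lambda>x. \<Prod>i\<in>I. f i x)"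
  by (induction I rule: infinite_finite_induct) (auto intro: Ck_const Ck_mult)

lemma Ck_sum: "(\<And>i. i \<in> I \<Longrightarrow> Ck k (f i)) \<Longrightarrow> Ck k (\<lambda>x. \<Sum>i\<in>I. f i x)"
  by (induction I rule: infinite_finite_induct) (auto intro: Ck_const Ck_add)

lemma Ck_translate: "Ck k f \<Longrightarrow> Ck k (\<lambda>x. f (x + v))"
proof (induction k arbitrary: f)
  case 0
  have "continuous_on UNIV (\<lambda>x. x + v)" by (intro continuous_intros)
  with 0 show ?case by (auto elim: continuous_on_compose2)
next
  case (Suc k)
  have "((\<lambda>x. f (x + v)) has_derivative frechet_derivative f (at (x + v))) (at x)" for x
  proof (rule has_derivative_compose[OF _ CkD_Suc(1)[OF Suc.prems]])
    show "((\<lambda>x. x + v) has_derivative (\<lambda>x. x)) (at x)"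
      by (auto intro!: derivative_eq_intros)
  qed
  then show ?case
    by (rule Ck_SucI) (use Suc.IH CkD_Suc(2)[OF Suc.prems] in auto)
qed

lemma Ck_compose:
  fixes h :: "real \<Rightarrow> real"
  shows "Ck k h \<Longrightarrow> Ck k f \<Longrightarrow> Ck k (\<lambda>x. h (f x))"
proof (induction k arbitrary: f h)
  case 0
  then show ?case by (auto elim: continuous_on_compose2)
next
  case (Suc k)
  let ?h' = "\<lambda>t. frechet_derivative h (at t) 1"
  \<comment> \<open>A linear map of the line is multiplication by its value at 1, so the chain rule
    becomes a product and \<open>Ck_mult\<close> applies.\<close>
  have lin: "frechet_derivative h (at t) s = s * ?h' t" for t s
    using linear_scale[OF has_derivative_linear[OF CkD_Suc(1)[OF Suc.prems(1)]], of t s 1] by simp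
  show ?case
  proof (rule Ck_SucI[OF has_derivative_compose[OF CkD_Suc(1)[OF Suc.prems(2)] CkD_Suc(1)[OF Suc.prems(1)]]])
    fix i :: 'a assume i: "i \<in> Basis"
    have "Ck k (\<lambda>x. frechet_derivative f (at x) i * ?h' (f x))"
      by (rule Ck_mult[OF CkD_Suc(2)[OF Suc.prems(2) i]
            Suc.IH[OF CkD_Suc(2)[OF Suc.prems(1)] Ck_lower[OF Suc.prems(2)]]]) simp
    then show "Ck k (\<lambda>x. frechet_derivative h (at (f x)) (frechet_derivative f (at x) i))"
      by (subst lin)
  qed
qed

section \<open>Smooth cutoff functions from the flat function exp(-1/x)\<close>

definition exp_tail :: "real poly \<Rightarrow> real \<Rightarrow> real" where
  "exp_tail P x = (if x > 0 then poly P (1 / x) * exp (- (1 / x)) else 0)"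

lemma exp_tail_tendsto_0: "(exp_tail P \<longlongrightarrow> 0) (at 0)"
proof -
  have "((\<lambda>t. \<Sum>i\<le>degree P. coeff P i * (t ^ i / exp t)) \<longlongrightarrow> 0) at_top"
    by (intro tendsto_null_sum tendsto_mult_right_zero tendsto_power_div_exp_0)
  then have "((\<lambda>t. poly P t * exp (- t)) \<longlongrightarrow> 0) at_top"
    by (simp add: poly_altdef sum_distrib_right exp_minus divide_inverse mult.assoc)
  then have "((\<lambda>x. poly P (1 / x) * exp (- (1 / x))) \<longlongrightarrow> 0) (at_right 0)"
    by (rule filterlim_compose) (simp add: filterlim_inverse_at_top_right flip: inverse_eq_divide)
  then have R: "(exp_tail P \<longlongrightarrow> 0) (at_right 0)"
    by (rule Lim_transform_eventually)
      (auto simp: exp_tail_def eventually_at_filter)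
  have "(exp_tail P \<longlongrightarrow> 0) (at_left 0)"
    by (rule Lim_transform_eventually[of "\<lambda>_. 0"])
      (auto simp: exp_tail_def eventually_at_filter)
  with R show ?thesis
    by (simp add: filterlim_split_at)
qed

text \<open>For x > 0 the derivative of P(1/x) exp(-1/x) is x^(-2) (P - P')(1/x) exp(-1/x), and
  \<open>[:0, 0, 1:]\<close> is the monomial t^2 at t = 1/x. The family is closed under
  differentiation, which is why \<open>exp_tail\<close> carries a polynomial: one induction then
  gives all orders.\<close>

lemma exp_tail_has_derivative:
  "(exp_tail P has_real_derivative exp_tail ([:0, 0, 1:] * (P - pderiv P)) x) (at x)"
proof (cases x "0::real" rule: linorder_cases)
  case less
  have "((\<lambda>x. 0) has_real_derivative 0) (at x)" by simp
  then have "(exp_tail P has_real_derivative 0) (at x)"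
    by (rule has_field_derivative_transform_within[where d="-x"])
      (use less in \<open>auto simp: exp_tail_def dist_real_def\<close>)
  with less show ?thesis by (simp add: exp_tail_def)
next
  case equal
  \<comment> \<open>\<open>pCons 0 P\<close> is t P(t), so \<open>exp_tail (pCons 0 P) y\<close> is
    the difference quotient of \<open>exp_tail P\<close> at 0.\<close>
  have "((\<lambda>y. exp_tail (pCons 0 P) y) \<longlongrightarrow> 0) (at 0)"
    by (rule exp_tail_tendsto_0)
  then have "((\<lambda>y. (exp_tail P y - exp_tail P 0) / (y - 0)) \<longlongrightarrow> 0) (at 0)"
    by (rule Lim_transform_eventually) (auto simp: exp_tail_def eventually_at_filter)
  then show ?thesis
    by (simp add: equal exp_tail_def has_field_derivative_iff)
next
  case greater
  have "((\<lambda>x. poly P (1 / x) * exp (- (1 / x))) has_real_derivative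
      poly ([:0, 0, 1:] * (P - pderiv P)) (1 / x) * exp (- (1 / x))) (at x)"
  proof -
    have 1: "((\<lambda>x. 1 / x) has_real_derivative - (1 / x\<^sup>2)) (at x)"
      using greater by (auto intro!: derivative_eq_intros simp: power2_eq_square)
    have 2: "((\<lambda>x. exp (- (1 / x))) has_real_derivative exp (- (1 / x)) * (1 / x\<^sup>2)) (at x)"
      using DERIV_chain2[OF DERIV_exp DERIV_minus[OF 1]] by simp
    show ?thesis
      using DERIV_mult[OF DERIV_chain2[OF poly_DERIV[of P] 1] 2]
      by (rule DERIV_cong) (simp add: diff_divide_distrib algebra_simps power2_eq_square)
  qed
  then have "(exp_tail P has_real_derivative
      poly ([:0, 0, 1:] * (P - pderiv P)) (1 / x) * exp (- (1 / x))) (at x)"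
    by (rule has_field_derivative_transform_within[where d=x])
      (use greater in \<open>auto simp: exp_tail_def dist_real_def\<close>)
  with greater show ?thesis by (simp add: exp_tail_def)
qed

lemma Ck_exp_tail: "Ck k (exp_tail P)"
proof (induction k arbitrary: P)
  case 0
  show ?case
    unfolding Ck.simps
    by (intro continuous_at_imp_continuous_on ballI DERIV_isCont[OF exp_tail_has_derivative])
next
  case (Suc k)
  show ?case
    by (rule Ck_SucI[OF exp_tail_has_derivative[unfolded has_field_derivative_def]])
      (rule Ck_mult[OF Suc Ck_const])
qed

text \<open>Nesting \<open>e(t) = exp (- 1 / t)\<close> as \<open>e(e(1) - e(x))\<close> gives a step that is constant for
  \<open>x \<le> 0\<close>, without dividing by a sum of two such functions.\<close>

definition smooth_step :: "real \<Rightarrow> real" where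
  "smooth_step x = exp_tail 1 (exp_tail 1 1 - exp_tail 1 x) / exp_tail 1 (exp_tail 1 1)"

lemma exp_tail_1: "exp_tail 1 x \<ge> 0" "x \<le> 0 \<Longrightarrow> exp_tail 1 x = 0" "x > 0 \<Longrightarrow> exp_tail 1 x > 0"
  and exp_tail_1_mono: "x \<le> y \<Longrightarrow> exp_tail 1 x \<le> exp_tail 1 y"
  by (auto simp: exp_tail_def intro!: frac_le)

lemma Ck_smooth_step: "Ck k smooth_step"
proof -
  have "Ck k (\<lambda>x. exp_tail 1 (exp_tail 1 1 - exp_tail 1 x))"
    by (rule Ck_compose[OF Ck_exp_tail Ck_diff[OF Ck_const Ck_exp_tail]])
  from Ck_cmult[OF this, of "1 / exp_tail 1 (exp_tail 1 1)"] show ?thesis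
    by (simp add: smooth_step_def[abs_def])
qed

lemma smooth_step:
  shows "0 \<le> smooth_step x" "smooth_step x \<le> 1"
    and "x \<le> 0 \<Longrightarrow> smooth_step x = 1" "x \<ge> 1 \<Longrightarrow> smooth_step x = 0"
proof -
  have *: "exp_tail 1 (exp_tail 1 1) > 0" by (simp add: exp_tail_1)
  show "0 \<le> smooth_step x" by (simp add: smooth_step_def exp_tail_1)
  have "exp_tail 1 (exp_tail 1 1 - exp_tail 1 x) \<le> exp_tail 1 (exp_tail 1 1)"
    by (intro exp_tail_1_mono) (simp add: exp_tail_1)
  with * show "smooth_step x \<le> 1" by (simp add: smooth_step_def)
  show "smooth_step x = 1" if "x \<le> 0" using less_imp_neq[OF *] that by (simp add: smooth_step_def exp_tail_1)
  show "smooth_step x = 0" if "x \<ge> 1" using * exp_tail_1_mono[OF that]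
    by (simp add: smooth_step_def exp_tail_1(2))
qed

text \<open>\<open>1 - \<Prod>(1 - b\<^sub>c)\<close> over a finite family of bumps \<open>b\<^sub>c\<close>, each equal to \<open>1\<close> on a ball
  \<open>ball c (r c)\<close>, where these balls cover \<open>K\<close>.\<close>

lemma smooth_Urysohn:
  fixes K U :: "'a::euclidean_space set"
  assumes "compact K" "open U" "K \<subseteq> U"
  obtains \<psi> W where "\<psi> \<in> test_functions U" "\<And>x. 0 \<le> \<psi> x" "\<And>x. \<psi> x \<le> 1"
    "open W" "K \<subseteq> W" "\<And>x. x \<in> W \<Longrightarrow> \<psi> x = 1"
proof -
  have "\<forall>c\<in>K. \<exists>r>0. cball c (2 * r) \<subseteq> U"
  proof
    fix c assume "c \<in> K"
    then obtain e where "e > 0" "cball c e \<subseteq> U"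
      using assms open_contains_cball by (metis subsetD)
    then show "\<exists>r>0. cball c (2 * r) \<subseteq> U" by (intro exI[of _ "e / 2"]) auto
  qed
  then obtain r where r: "\<And>c. c \<in> K \<Longrightarrow> r c > 0" "\<And>c. c \<in> K \<Longrightarrow> cball c (2 * r c) \<subseteq> U"
    by metis
  have "K \<subseteq> (\<Union>c\<in>K. ball c (r c))" using r by force
  then obtain D where D: "D \<subseteq> K" "finite D" "K \<subseteq> (\<Union>c\<in>D. ball c (r c))"
    using compactE_image[OF \<open>compact K\<close>, of K "\<lambda>c. ball c (r c)"] by (metis open_ball)
  \<comment> \<open>The argument is \<le> 0 for |x - c| \<le> \<open>r c\<close> and \<ge> 1 for |x
    - c| \<ge> 2 \<open>r c\<close>, as 3 = 2^2 - 1. The squared distance is a polynomial, hence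
    smooth also at the centre.\<close>
  define b where "b c x = smooth_step (((x - c) \<bullet> (x - c) / (r c)\<^sup>2 - 1) / 3)" for c x :: 'a
  define \<psi> where "\<psi> x = 1 - (\<Prod>c\<in>D. (1 - b c x))" for x
  have Cb: "Ck k (b c)" for k c
  proof -
    have sq: "Ck k (\<lambda>x::'a. x \<bullet> x)"
    proof -
      have "Ck k (\<lambda>x::'a. \<Sum>i\<in>Basis. (x \<bullet> i) * (x \<bullet> i))"
        by (intro Ck_sum Ck_mult Ck_bounded_linear bounded_linear_inner_left)
      then show ?thesis by (subst euclidean_inner)
    qed
    have "Ck k (\<lambda>x. (1 / (3 * (r c)\<^sup>2)) * ((x + - c) \<bullet> (x + - c)) + - 1 / 3)"
      by (intro Ck_add Ck_cmult Ck_const Ck_translate[OF sq])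
    then have "Ck k (\<lambda>x. smooth_step ((1 / (3 * (r c)\<^sup>2)) * ((x + - c) \<bullet> (x + - c)) + - 1 / 3))"
      by (rule Ck_compose[OF Ck_smooth_step])
    moreover have "b c = (\<lambda>x. smooth_step ((1 / (3 * (r c)\<^sup>2)) * ((x + - c) \<bullet> (x + - c)) + - 1 / 3))"
      unfolding b_def by (intro ext arg_cong[where f=smooth_step]) (simp add: diff_divide_distrib)
    ultimately show ?thesis by simp
  qed
  have C\<psi>: "Ck k \<psi>" for k
    unfolding \<psi>_def by (intro Ck_diff Ck_const Ck_prod Cb)
  have b01: "0 \<le> b c x" "b c x \<le> 1" for c x
    unfolding b_def by (rule smooth_step)+
  have b1: "b c x = 1" if "c \<in> K" "x \<in> ball c (r c)" for c x
  proof -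
    have "(x - c) \<bullet> (x - c) \<le> (r c)\<^sup>2"
      using that r(1)[of c] by (simp add: dist_norm norm_minus_commute dot_square_norm power_mono)
    then show ?thesis unfolding b_def using r(1)[OF that(1)]
      by (intro smooth_step(3)) (simp add: field_simps)
  qed
  have b0: "b c x = 0" if "c \<in> K" "x \<notin> cball c (2 * r c)" for c x
  proof -
    have "2 * r c \<le> norm (x - c)"
      using that by (simp add: dist_norm norm_minus_commute)
    then have "(2 * r c)\<^sup>2 \<le> (x - c) \<bullet> (x - c)"
      using r(1)[OF that(1)] by (simp only: dot_square_norm) (intro power_mono, auto)
    then show ?thesis unfolding b_def using r(1)[OF that(1)]
      by (intro smooth_step(4)) (simp add: field_simps)
  qed
  have sub: "{x. \<psi> x \<noteq> 0} \<subseteq> (\<Union>c\<in>D. cball c (2 * r c))"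
  proof
    fix x assume x: "x \<in> {x. \<psi> x \<noteq> 0}"
    show "x \<in> (\<Union>c\<in>D. cball c (2 * r c))"
    proof (rule ccontr)
      assume "\<not> ?thesis"
      then have "(\<Prod>c\<in>D. (1 - b c x)) = 1"
        using b0 D(1) by (intro prod.neutral) auto
      with x show False by (simp add: \<psi>_def)
    qed
  qed
  have cD: "compact (\<Union>c\<in>D. cball c (2 * r c))" using D(2) by (intro compact_UN) auto
  have csub: "closure {x. \<psi> x \<noteq> 0} \<subseteq> (\<Union>c\<in>D. cball c (2 * r c))"
    using sub cD by (intro closure_minimal compact_imp_closed)
  then have "compact (closure {x. \<psi> x \<noteq> 0})"
    by (metis Int_absorb1 compact_Int_closed cD closed_closure)
  moreover have "closure {x. \<psi> x \<noteq> 0} \<subseteq> U"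
    using csub D(1) r(2) by blast
  ultimately have "\<psi> \<in> test_functions U"
    using C\<psi> by (simp add: test_functions_def compact_support_in_def)
  moreover have "0 \<le> (\<Prod>c\<in>D. (1 - b c x))" "(\<Prod>c\<in>D. (1 - b c x)) \<le> 1" for x
    using b01 by (auto intro!: prod_nonneg prod_le_1)
  then have "0 \<le> \<psi> x" "\<psi> x \<le> 1" for x
    by (simp_all add: \<psi>_def)
  moreover have "\<psi> x = 1" if "x \<in> (\<Union>c\<in>D. ball c (r c))" for x
  proof -
    from that obtain c where c: "c \<in> D" "x \<in> ball c (r c)" by auto
    then have "1 - b c x = 0" using b1 D(1) by auto
    then have "(\<Prod>c\<in>D. (1 - b c x)) = 0" using c D(2) by (intro prod_zero) auto
    then show ?thesis by (simp add: \<psi>_def)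
  qed
  moreover have "open (\<Union>c\<in>D. ball c (r c))" by auto
  ultimately show ?thesis using D(3) that by blast
qed

subsection \<open>Test functions\<close>

lemma test_functions_mono: "\<phi> \<in> test_functions U \<Longrightarrow> U \<subseteq> V \<Longrightarrow> \<phi> \<in> test_functions V"
  by (auto simp: test_functions_def compact_support_in_def)

lemma test_functionD:
  assumes "\<phi> \<in> test_functions U"
  shows "Ck k \<phi>" "(\<phi> has_derivative frechet_derivative \<phi> (at x)) (at x)"
    "continuous_on A \<phi>" "compact (closure {x. \<phi> x \<noteq> 0})" "closure {x. \<phi> x \<noteq> 0} \<subseteq> U"
proof -
  show *: "Ck k \<phi>" for k using assms by (auto simp: test_functions_def)
  show "(\<phi> has_derivative frechet_derivative \<phi> (at x)) (at x)"
    using *[of 1] CkD_Suc(1) by (metis One_nat_def)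
  show "continuous_on A \<phi>"
    using *[of 0] by (auto intro: continuous_on_subset)
  show "compact (closure {x. \<phi> x \<noteq> 0})" "closure {x. \<phi> x \<noteq> 0} \<subseteq> U"
    using assms by (auto simp: test_functions_def compact_support_in_def)
qed

lemma test_functionI:
  assumes "\<And>k. Ck k \<phi>" "compact K" "K \<subseteq> U" "\<And>x. x \<notin> K \<Longrightarrow> \<phi> x = 0"
  shows "\<phi> \<in> test_functions U"
proof -
  have "{x. \<phi> x \<noteq> 0} \<subseteq> K" using assms(4) by blast
  then have sub: "closure {x. \<phi> x \<noteq> 0} \<subseteq> K"
    using assms(2) by (intro closure_minimal compact_imp_closed)
  then have "compact (closure {x. \<phi> x \<noteq> 0})"
    by (metis Int_absorb1 compact_Int_closed assms(2) closed_closure)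
  then show ?thesis using assms sub by (auto simp: test_functions_def compact_support_in_def)
qed

text \<open>The complement of the closed support is open, so \<phi> agrees with the constant 0 near
  x, and a derivative depends only on the values nearby.\<close>

lemma test_function_off_support:
  assumes "x \<notin> closure {x. \<phi> x \<noteq> 0}"
  shows "\<phi> x = 0" "frechet_derivative \<phi> (at x) = (\<lambda>v. 0)"
proof -
  have 0: "\<phi> y = 0" if "y \<notin> closure {x. \<phi> x \<noteq> 0}" for y
    using that subsetD[OF closure_subset, of y "{x. \<phi> x \<noteq> 0}"] by blast
  then show "\<phi> x = 0" using assms .
  have "(\<phi> has_derivative (\<lambda>v. 0)) (at x)"
  proof (rule has_derivative_transform_within_open[OF has_derivative_const])
    show "open (- closure {x. \<phi> x \<noteq> 0})" by (simp only: open_Compl closed_closure)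
    show "x \<in> - closure {x. \<phi> x \<noteq> 0}" using assms by blast
    show "0 = \<phi> y" if "y \<in> - closure {x. \<phi> x \<noteq> 0}" for y
      using 0 that by (metis ComplD)
  qed
  then show "frechet_derivative \<phi> (at x) = (\<lambda>v. 0)"
    by (metis frechet_derivative_at)
qed

lemma test_function_off_set:
  assumes "\<phi> \<in> test_functions U" "x \<notin> U"
  shows "\<phi> x = 0" "frechet_derivative \<phi> (at x) v = 0"
proof -
  have "x \<notin> closure {x. \<phi> x \<noteq> 0}" using test_functionD(5)[OF assms(1)] assms(2) by blast
  from test_function_off_support[OF this] show "\<phi> x = 0" "frechet_derivative \<phi> (at x) v = 0"
    by (simp_all only:)
qed

lemma test_function_bounded:
  assumes "\<phi> \<in> test_functions U"
  obtains B where "B > 0" "\<And>x. \<bar>\<phi> x\<bar> \<le> B"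
proof -
  let ?K = "closure {x. \<phi> x \<noteq> 0}"
  have "bounded (\<phi> ` ?K)"
    using assms by (intro compact_imp_bounded compact_continuous_image test_functionD)
  then obtain B where B: "B > 0" "\<And>x. x \<in> ?K \<Longrightarrow> \<bar>\<phi> x\<bar> \<le> B"
    by (auto simp: bounded_pos)
  have "\<bar>\<phi> x\<bar> \<le> B" for x
    using B test_function_off_support(1)[of x \<phi>] by (cases "x \<in> ?K") auto
  with B show ?thesis using that by blast
qed

lemma test_function_measurable:
  assumes "\<phi> \<in> test_functions U" shows "\<phi> \<in> borel_measurable lebesgue"
  using borel_measurable_continuous_onI[OF test_functionD(3)[OF assms]]
  by (simp add: measurable_completion)

text \<open>\<open>Ck\<close> speaks only of the directions in \<open>Basis\<close>; linearity of
  the derivative covers the others. The positive part needs the direction -e next to a basis vector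
  e.\<close>

lemma test_function_directional_deriv:
  assumes "\<phi> \<in> test_functions U"
  shows "(\<lambda>x. frechet_derivative \<phi> (at x) e) \<in> test_functions U"
proof -
  have "frechet_derivative \<phi> (at x) e = (\<Sum>i\<in>Basis. (e \<bullet> i) * frechet_derivative \<phi> (at x) i)" for x
  proof -
    interpret linear "frechet_derivative \<phi> (at x)"
      using test_functionD(2)[OF assms] by (rule has_derivative_linear)
    show ?thesis
      by (subst euclidean_representation[of e, symmetric]) (simp add: sum scale)
  qed
  moreover have "Ck k (\<lambda>x. \<Sum>i\<in>Basis. (e \<bullet> i) * frechet_derivative \<phi> (at x) i)" for k
    by (rule Ck_sum, rule Ck_cmult, rule CkD_Suc(2)[OF test_functionD(1)[OF assms]])
  ultimately have "Ck k (\<lambda>x. frechet_derivative \<phi> (at x) e)" for k by presburger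
  then show ?thesis
    by (rule test_functionI[OF _ test_functionD(4,5)[OF assms]])
      (drule test_function_off_support(2), erule fun_cong)
qed

lemma test_function_translate:
  assumes "\<phi> \<in> test_functions V" "\<And>x. x \<in> V \<Longrightarrow> x + v \<in> U"
  shows "(\<lambda>x. \<phi> (x - v)) \<in> test_functions U"
proof (rule test_functionI)
  let ?K = "closure {x. \<phi> x \<noteq> 0}"
  show "Ck k (\<lambda>x. \<phi> (x - v))" for k
    using Ck_translate[OF test_functionD(1)[OF assms(1)], of k "-v"] by simp
  show "compact ((+) v ` ?K)"
    by (intro compact_translation test_functionD[OF assms(1)])
  show "(+) v ` ?K \<subseteq> U"
    using test_functionD(5)[OF assms(1)] assms(2) by (auto simp: add.commute)
  fix x assume "x \<notin> (+) v ` ?K"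
  then have "x - v \<notin> ?K"
    using image_eqI[of x "(+) v" "x - v" ?K] by auto
  then show "\<phi> (x - v) = 0" by (rule test_function_off_support(1))
qed

lemma frechet_derivative_translate:
  assumes "\<phi> \<in> test_functions U"
  shows "frechet_derivative (\<lambda>x. \<phi> (x - v)) (at x) = frechet_derivative \<phi> (at (x - v))"
proof -
  have "((\<lambda>x. x - v) has_derivative (\<lambda>x. x)) (at x)" by (auto intro!: derivative_eq_intros)
  from has_derivative_compose[OF this test_functionD(2)[OF assms]]
  show ?thesis by (rule frechet_derivative_at[symmetric])
qed

lemma test_function_mult:
  assumes "\<phi> \<in> test_functions U" "\<psi> \<in> test_functions V"
  shows "(\<lambda>x. \<phi> x * \<psi> x) \<in> test_functions (U \<inter> V)"
    "frechet_derivative (\<lambda>x. \<phi> x * \<psi> x) (at x) v =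
      \<phi> x * frechet_derivative \<psi> (at x) v + frechet_derivative \<phi> (at x) v * \<psi> x"
proof -
  show "(\<lambda>x. \<phi> x * \<psi> x) \<in> test_functions (U \<inter> V)"
  proof (rule test_functionI)
    show "Ck k (\<lambda>x. \<phi> x * \<psi> x)" for k
      by (rule Ck_mult; rule test_functionD[OF assms(1)] test_functionD[OF assms(2)])
    show "compact (closure {x. \<phi> x \<noteq> 0} \<inter> closure {x. \<psi> x \<noteq> 0})"
      by (intro compact_Int test_functionD[OF assms(1)] test_functionD[OF assms(2)])
    show "closure {x. \<phi> x \<noteq> 0} \<inter> closure {x. \<psi> x \<noteq> 0} \<subseteq> U \<inter> V"
      using test_functionD(5)[OF assms(1)] test_functionD(5)[OF assms(2)] by blast
    show "\<phi> x * \<psi> x = 0" if "x \<notin> closure {x. \<phi> x \<noteq> 0} \<inter> closure {x. \<psi> x \<noteq> 0}" for x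
      using that test_function_off_support(1)[of x \<phi>] test_function_off_support(1)[of x \<psi>] by auto
  qed
  show "frechet_derivative (\<lambda>x. \<phi> x * \<psi> x) (at x) v =
      \<phi> x * frechet_derivative \<psi> (at x) v + frechet_derivative \<phi> (at x) v * \<psi> x"
    by (subst frechet_derivative_at[OF has_derivative_mult[OF test_functionD(2)[OF assms(1)]
            test_functionD(2)[OF assms(2)]], symmetric]) simp
qed

lemma test_function_has_real_derivative:
  assumes "\<phi> \<in> test_functions U"
  shows "((\<lambda>t. \<phi> (x - t *\<^sub>R e)) has_real_derivative - frechet_derivative \<phi> (at (x - t *\<^sub>R e)) e) (at t)"
proof -
  have "((\<lambda>t. x - t *\<^sub>R e) has_derivative (\<lambda>s. - (s *\<^sub>R e))) (at t)"
    by (auto intro!: derivative_eq_intros)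
  from has_derivative_compose[OF this test_functionD(2)[OF assms]]
  have *: "((\<lambda>t. \<phi> (x - t *\<^sub>R e)) has_derivative
      (\<lambda>s. frechet_derivative \<phi> (at (x - t *\<^sub>R e)) (- (s *\<^sub>R e)))) (at t)" .
  interpret linear "frechet_derivative \<phi> (at (x - t *\<^sub>R e))"
    using test_functionD(2)[OF assms] by (rule has_derivative_linear)
  show ?thesis unfolding has_field_derivative_def
    by (rule has_derivative_eq_rhs[OF *]) (auto simp: neg scale)
qed

lemma test_function_Lipschitz:
  assumes "\<phi> \<in> test_functions U"
  obtains L where "L > 0" "\<And>x s t. \<bar>\<phi> (x - t *\<^sub>R e) - \<phi> (x - s *\<^sub>R e)\<bar> \<le> L * \<bar>t - s\<bar>"
    "\<And>x. \<bar>frechet_derivative \<phi> (at x) e\<bar> \<le> L"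
proof -
  obtain L where L: "L > 0" "\<And>x. \<bar>frechet_derivative \<phi> (at x) e\<bar> \<le> L"
    using test_function_bounded[OF test_function_directional_deriv[OF assms, of e]] by blast
  have "\<bar>\<phi> (x - t *\<^sub>R e) - \<phi> (x - s *\<^sub>R e)\<bar> \<le> L * \<bar>t - s\<bar>" for x s t
    using field_differentiable_bound[where S=UNIV and f="\<lambda>t. \<phi> (x - t *\<^sub>R e)" and B=L,
        OF _ test_function_has_real_derivative[OF assms]] L by auto
  with L show ?thesis using that by blast
qed

subsection \<open>The fundamental lemma\<close>

lemma integrable_mult_bounded:
  fixes f g :: "'a \<Rightarrow> real"
  assumes "integrable M f" "g \<in> borel_measurable M" "\<And>x. \<bar>g x\<bar> \<le> B"
  shows "integrable M (\<lambda>x. f x * g x)"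
proof (rule Bochner_Integration.integrable_bound)
  show "integrable M (\<lambda>x. B * f x)" using assms(1) by simp
  show "AE x in M. norm (f x * g x) \<le> norm (B * f x)"
  proof (rule AE_I2)
    fix x
    have "\<bar>f x\<bar> * \<bar>g x\<bar> \<le> \<bar>f x\<bar> * B" by (intro mult_left_mono assms) auto
    also have "\<dots> \<le> \<bar>f x\<bar> * \<bar>B\<bar>" by (intro mult_left_mono) auto
    finally show "norm (f x * g x) \<le> norm (B * f x)" by (simp add: abs_mult mult.commute)
  qed
qed (use assms in measurable)

lemma integrable_mult_test:
  assumes "integrable lebesgue f" "\<phi> \<in> test_functions U"
  shows "integrable lebesgue (\<lambda>x. f x * \<phi> x)"
  using test_function_bounded[OF assms(2)] integrable_mult_bounded[OF assms(1) test_function_measurable[OF assms(2)]]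
  by metis

text \<open>Cutoffs for shrinking neighbourhoods of K converge pointwise to the indicator of K,
  because a point off K has positive distance from it; |H| dominates. Smooth tests are thereby
  replaced by a rough one.\<close>

lemma test_bound_compact:
  fixes H :: "'a::euclidean_space \<Rightarrow> real"
  assumes H: "integrable lebesgue H" and V: "open V" and K: "compact K" "K \<subseteq> V"
    and bound: "\<And>\<psi>. \<psi> \<in> test_functions V \<Longrightarrow> (\<And>x. 0 \<le> \<psi> x \<and> \<psi> x \<le> 1) \<Longrightarrow>
      \<bar>LINT x|lebesgue. H x * \<psi> x\<bar> \<le> c"
  shows "\<bar>LINT x|lebesgue. H x * indicator K x\<bar> \<le> c"
proof -
  define U where "U n = V \<inter> (\<Union>k\<in>K. ball k (1 / real (Suc n)))" for n
  have "\<exists>\<psi>. \<psi> \<in> test_functions (U n) \<and> (\<forall>x. 0 \<le> \<psi> x \<and> \<psi> x \<le> 1) \<and> (\<forall>x\<in>K. \<psi> x = 1)" for n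
  proof -
    have "open (U n)" "K \<subseteq> U n" using V K by (auto simp: U_def)
    from smooth_Urysohn[OF K(1) this] show ?thesis by (metis subsetD)
  qed
  then obtain \<psi> where \<psi>: "\<And>n. \<psi> n \<in> test_functions (U n)" "\<And>n x. 0 \<le> \<psi> n x" "\<And>n x. \<psi> n x \<le> 1"
      "\<And>n x. x \<in> K \<Longrightarrow> \<psi> n x = 1"
    by metis
  have "(\<lambda>n. LINT x|lebesgue. H x * \<psi> n x) \<longlonglongrightarrow> (LINT x|lebesgue. H x * indicator K x)"
  proof (rule integral_dominated_convergence[where w="\<lambda>x. \<bar>H x\<bar>"])
    have "K \<in> sets lebesgue" by (rule fmeasurableD[OF lmeasurable_compact[OF K(1)]])
    then show "(\<lambda>x. H x * indicator K x) \<in> borel_measurable lebesgue"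
      using H by measurable
    show "(\<lambda>x. H x * \<psi> n x) \<in> borel_measurable lebesgue" for n
      using borel_measurable_integrable[OF integrable_mult_test[OF H \<psi>(1)]] .
    show "AE x in lebesgue. norm (H x * \<psi> n x) \<le> \<bar>H x\<bar>" for n
      using \<psi>(2,3)[of n] by (auto simp: abs_mult intro!: mult_left_le)
    show "AE x in lebesgue. (\<lambda>n. H x * \<psi> n x) \<longlonglongrightarrow> H x * indicator K x"
    proof (intro AE_I2 tendsto_mult_left)
      fix x
      show "(\<lambda>n. \<psi> n x) \<longlonglongrightarrow> indicat_real K x"
      proof (cases "x \<in> K")
        case True
        then show ?thesis by (simp add: \<psi>(4))
      next
        case False
        then obtain e where e: "e > 0" "ball x e \<inter> K = {}"
          using compact_imp_closed[OF K(1)] by (metis open_Compl Compl_iff disjoint_eq_subset_Compl openE)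
        obtain N where N: "1 / real (Suc N) < e" using e(1) nat_approx_posE by blast
        have "\<psi> n x = 0" if "n \<ge> N" for n
        proof (rule test_function_off_set(1)[OF \<psi>(1)])
          have "1 / real (Suc n) \<le> 1 / real (Suc N)" using that by (intro frac_le) auto
          with N have "1 / real (Suc n) < e" by simp
          then show "x \<notin> U n"
            using e(2) by (auto simp: U_def disjoint_iff dist_commute)
        qed
        then have "\<forall>\<^sub>F n in sequentially. \<psi> n x = indicator K x"
          using False by (auto simp: eventually_sequentially)
        then show ?thesis by (rule tendsto_eventually)
      qed
    qed
  qed (use H in auto)
  moreover have "\<bar>LINT x|lebesgue. H x * \<psi> n x\<bar> \<le> c" for n
    by (rule bound[OF test_functions_mono[OF \<psi>(1)]]) (auto simp: U_def \<psi>)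
  ultimately show ?thesis
    using LIMSEQ_le_const2[OF tendsto_rabs] by blast
qed

text \<open>A Lebesgue set is an F-sigma set up to a null set, and an F-sigma set in Euclidean space
  is a countable union of compact sets, exhausted by its finite partial unions. The null remainder
  is the reason why the convergence is only almost everywhere.\<close>

lemma lebesgue_compact_exhaustion:
  fixes A :: "'a::euclidean_space set"
  assumes "A \<in> sets lebesgue"
  obtains K :: "nat \<Rightarrow> 'a set" where "\<And>n. compact (K n)" "\<And>n. K n \<subseteq> A"
    "AE x in lebesgue. (\<lambda>n. indicat_real (K n) x) \<longlonglongrightarrow> indicat_real A x"
proof -
  obtain C T where CT: "fsigma C" "T \<in> null_sets lebesgue" "C \<union> T = A"
    using lebesgue_set_almost_fsigma[OF assms] by metis
  obtain F where F: "\<And>n::nat. compact (F n)" "C = (\<Union>n. F n)"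
    using CT(1) by (metis fsigma_Union_compact image_subset_iff mem_Collect_eq UNIV_I)
  define K where "K n = (\<Union>j\<le>n. F j)" for n
  have "AE x in lebesgue. (\<lambda>n. indicat_real (K n) x) \<longlonglongrightarrow> indicat_real A x"
    using AE_not_in[OF CT(2)]
  proof eventually_elim
    case (elim x)
    show ?case
    proof (cases "x \<in> A")
      case True
      then obtain N where "x \<in> F N" using F CT(3) elim by auto
      then have "\<forall>n\<ge>N. indicator (K n) x = (indicator A x :: real)"
        using True by (auto simp: K_def indicator_def)
      then show ?thesis by (intro tendsto_eventually) (auto simp: eventually_sequentially)
    next
      case False
      then have "indicator (K n) x = (indicator A x :: real)" for n
        using F CT(3) by (auto simp: K_def indicator_def)
      then show ?thesis by simp
    qed
  qed
  moreover have "compact (K n)" "K n \<subseteq> A" for n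
    using F CT(3) by (auto simp: K_def)
  ultimately show ?thesis using that by blast
qed

lemma test_bound_set:
  fixes H :: "'a::euclidean_space \<Rightarrow> real"
  assumes H: "integrable lebesgue H" and V: "open V" and A: "A \<in> sets lebesgue" "A \<subseteq> V"
    and bound: "\<And>\<psi>. \<psi> \<in> test_functions V \<Longrightarrow> (\<And>x. 0 \<le> \<psi> x \<and> \<psi> x \<le> 1) \<Longrightarrow>
      \<bar>LINT x|lebesgue. H x * \<psi> x\<bar> \<le> c"
  shows "\<bar>LINT x|lebesgue. H x * indicator A x\<bar> \<le> c"
proof -
  obtain K :: "nat \<Rightarrow> 'a set" where K: "\<And>n. compact (K n)" "\<And>n. K n \<subseteq> A"
    and lim: "AE x in lebesgue. (\<lambda>n. indicat_real (K n) x) \<longlonglongrightarrow> indicat_real A x"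
    using lebesgue_compact_exhaustion[OF A(1)] by blast
  have Km: "K n \<in> sets lebesgue" for n by (rule fmeasurableD[OF lmeasurable_compact[OF K(1)]])
  have "(\<lambda>n. LINT x|lebesgue. H x * indicator (K n) x) \<longlonglongrightarrow> (LINT x|lebesgue. H x * indicator A x)"
  proof (rule integral_dominated_convergence[where w="\<lambda>x. \<bar>H x\<bar>"])
    show "(\<lambda>x. H x * indicator A x) \<in> borel_measurable lebesgue"
      using H A by measurable
    show "(\<lambda>x. H x * indicator (K n) x) \<in> borel_measurable lebesgue" for n
      using H Km[of n] by measurable
    show "AE x in lebesgue. norm (H x * indicator (K n) x) \<le> \<bar>H x\<bar>" for n
      by (auto simp: indicator_def)
    show "AE x in lebesgue. (\<lambda>n. H x * indicator (K n) x) \<longlonglongrightarrow> H x * indicator A x"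
      using lim by eventually_elim (rule tendsto_mult_left)
  qed (use H in auto)
  moreover have "\<bar>LINT x|lebesgue. H x * indicator (K n) x\<bar> \<le> c" for n
    by (rule test_bound_compact[OF H V K(1) order_trans[OF K(2) A(2)] bound])
  ultimately show ?thesis
    using LIMSEQ_le_const2[OF tendsto_rabs] by blast
qed

text \<open>The bound passes to the sets where H > 0 and where H < 0 separately; each contributes at
  most c, whence the factor 2. With c = 0 this gives the fundamental lemma, with c > 0 it turns a
  bound on pairings into an L1 bound.\<close>

lemma test_bound:
  fixes H :: "'a::euclidean_space \<Rightarrow> real"
  assumes H: "integrable lebesgue H" and V: "open V"
    and bound: "\<And>\<psi>. \<psi> \<in> test_functions V \<Longrightarrow> (\<And>x. 0 \<le> \<psi> x \<and> \<psi> x \<le> 1) \<Longrightarrow>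
      \<bar>LINT x|lebesgue. H x * \<psi> x\<bar> \<le> c"
  shows "(LINT x|lebesgue. \<bar>H x\<bar> * indicator V x) \<le> 2 * c"
proof -
  have [measurable]: "H \<in> borel_measurable lebesgue" "V \<in> sets lebesgue" using H V by auto
  define A where "A = {x\<in>space lebesgue. H x > 0} \<inter> V"
  define B where "B = {x\<in>space lebesgue. H x < 0} \<inter> V"
  have AB: "A \<in> sets lebesgue" "B \<in> sets lebesgue" "A \<subseteq> V" "B \<subseteq> V"
    unfolding A_def B_def by auto
  have int: "integrable lebesgue (\<lambda>x. H x * indicator S x)" if "S \<in> sets lebesgue" for S
    by (rule integrable_real_mult_indicator[OF that H])
  have "(LINT x|lebesgue. \<bar>H x\<bar> * indicator V x) =
      (LINT x|lebesgue. H x * indicator A x - H x * indicator B x)"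
    by (intro Bochner_Integration.integral_cong) (auto simp: A_def B_def indicator_def)
  also have "\<dots> = (LINT x|lebesgue. H x * indicator A x) - (LINT x|lebesgue. H x * indicator B x)"
    using AB int by (intro Bochner_Integration.integral_diff) auto
  also have "\<dots> \<le> 2 * c"
    using test_bound_set[OF H V AB(1,3) bound] test_bound_set[OF H V AB(2,4) bound] by fastforce
  finally show ?thesis .
qed

subsection \<open>Translations\<close>

lemma
  fixes v :: "'a::euclidean_space"
  shows distr_lebesgue_translate: "distr lebesgue lebesgue (\<lambda>x. x + v) = lebesgue"
    and measurable_lebesgue_translate: "(\<lambda>x. x + v) \<in> lebesgue \<rightarrow>\<^sub>M lebesgue"
proof -
  have eq: "(\<lambda>x. v + (\<Sum>j\<in>Basis. (1 * (x \<bullet> j)) *\<^sub>R j)) = (\<lambda>x. x + v)"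
    by (simp add: euclidean_representation add.commute)
  show "distr lebesgue lebesgue (\<lambda>x. x + v) = lebesgue"
    using lebesgue_affine_euclidean[of "\<lambda>_. 1" v] unfolding eq by (simp add: density_1)
  show "(\<lambda>x. x + v) \<in> lebesgue \<rightarrow>\<^sub>M lebesgue"
    using lebesgue_affine_measurable[of "\<lambda>_. 1" v] unfolding eq by simp
qed

lemma
  fixes f :: "'a::euclidean_space \<Rightarrow> real"
  assumes "integrable lebesgue f"
  shows integrable_translate: "integrable lebesgue (\<lambda>x. f (x + v))"
    and integral_translate: "(LINT x|lebesgue. f (x + v)) = (LINT x|lebesgue. f x)"
proof -
  have "integrable (distr lebesgue lebesgue (\<lambda>x. x + v)) f"
    using assms by (simp add: distr_lebesgue_translate)
  then show "integrable lebesgue (\<lambda>x. f (x + v))"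
    using integrable_distr_eq[OF measurable_lebesgue_translate] borel_measurable_integrable[OF assms]
    by blast
  have "(LINT x|lebesgue. f x) = (LINT x|distr lebesgue lebesgue (\<lambda>x. x + v). f x)"
    by (simp add: distr_lebesgue_translate)
  also have "\<dots> = (LINT x|lebesgue. f (x + v))"
    by (rule integral_distr[OF measurable_lebesgue_translate borel_measurable_integrable[OF assms]])
  finally show "(LINT x|lebesgue. f (x + v)) = (LINT x|lebesgue. f x)" ..
qed

text \<open>Integrability is part of the notion: the Bochner integral of a non-integrable function
  is 0, so the smallness condition alone could hold for the wrong reason.\<close>

definition L1_translation_continuous :: "('a::euclidean_space \<Rightarrow> real) \<Rightarrow> bool" where
  "L1_translation_continuous f \<longleftrightarrow> integrable lebesgue f \<and>
     (\<forall>\<epsilon>>0. \<exists>\<delta>>0. \<forall>v. norm v < \<delta> \<longrightarrow> (LINT x|lebesgue. \<bar>f (x + v) - f x\<bar>) < \<epsilon>)"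

text \<open>The class is closed in L1: by translation invariance the error f - g contributes the
  same amount, below \<epsilon>/4, at x and at x + v, and translating g contributes at most
  \<epsilon>/2.\<close>

lemma L1_translation_continuous_approx:
  fixes f :: "'a::euclidean_space \<Rightarrow> real"
  assumes f: "integrable lebesgue f"
    and g: "\<And>n. L1_translation_continuous (g n)"
    and lim: "(\<lambda>n. LINT x|lebesgue. \<bar>f x - g n x\<bar>) \<longlonglongrightarrow> 0"
  shows "L1_translation_continuous f"
  unfolding L1_translation_continuous_def
proof (intro conjI allI impI f)
  fix \<epsilon> :: real assume "\<epsilon> > 0"
  then have "\<forall>\<^sub>F n in sequentially. (LINT x|lebesgue. \<bar>f x - g n x\<bar>) < \<epsilon> / 4"
    using order_tendstoD(2)[OF lim, of "\<epsilon> / 4"] by simp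
  then obtain n where n: "(LINT x|lebesgue. \<bar>f x - g n x\<bar>) < \<epsilon> / 4"
    using eventually_happens'[OF sequentially_bot] by blast
  have gi: "integrable lebesgue (g n)" using g by (auto simp: L1_translation_continuous_def)
  obtain \<delta> where \<delta>: "\<delta> > 0" "\<And>v. norm v < \<delta> \<Longrightarrow> (LINT x|lebesgue. \<bar>g n (x + v) - g n x\<bar>) < \<epsilon> / 2"
    using g[of n] \<open>\<epsilon> > 0\<close> unfolding L1_translation_continuous_def by (meson half_gt_zero)
  show "\<exists>\<delta>>0. \<forall>v. norm v < \<delta> \<longrightarrow> (LINT x|lebesgue. \<bar>f (x + v) - f x\<bar>) < \<epsilon>"
  proof (intro exI[of _ \<delta>] conjI allI impI \<delta>(1))
    fix v :: 'a assume v: "norm v < \<delta>"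
    let ?d = "\<lambda>x. \<bar>f x - g n x\<bar>"
    have d: "integrable lebesgue ?d" using f gi by auto
    have dv: "integrable lebesgue (\<lambda>x. ?d (x + v))" by (rule integrable_translate[OF d])
    have gv: "integrable lebesgue (\<lambda>x. \<bar>g n (x + v) - g n x\<bar>)"
      using integrable_translate[OF gi] gi by auto
    have "(LINT x|lebesgue. \<bar>f (x + v) - f x\<bar>) \<le>
        (LINT x|lebesgue. (?d (x + v) + ?d x) + \<bar>g n (x + v) - g n x\<bar>)"
      using d dv gv f integrable_translate[OF f, of v] by (intro integral_mono) auto
    also have "\<dots> = (LINT x|lebesgue. ?d (x + v)) + (LINT x|lebesgue. ?d x) + (LINT x|lebesgue. \<bar>g n (x + v) - g n x\<bar>)"
      using d dv gv by simp
    also have "(LINT x|lebesgue. ?d (x + v)) = (LINT x|lebesgue. ?d x)"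
      by (rule integral_translate[OF d])
    finally show "(LINT x|lebesgue. \<bar>f (x + v) - f x\<bar>) < \<epsilon>"
      using n \<delta>(2)[OF v] by linarith
  qed
qed

text \<open>Outer regularity encloses K in an open U of little more measure, and a shift shorter
  than the distance from K to the complement of U cannot move K out of U.\<close>

lemma L1_translation_continuous_compact:
  fixes K :: "'a::euclidean_space set"
  assumes K: "compact K"
  shows "L1_translation_continuous (indicat_real K)"
  unfolding L1_translation_continuous_def
proof (intro conjI allI impI)
  have Km: "K \<in> lmeasurable" using K by (rule lmeasurable_compact)
  then show int: "integrable lebesgue (indicat_real K)"
    using lmeasurable_iff_integrable by blast
  fix \<epsilon> :: real assume "\<epsilon> > 0"
  then obtain U where U: "open U" "K \<subseteq> U" "U - K \<in> lmeasurable" "emeasure lebesgue (U - K) < ennreal (\<epsilon> / 2)"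
    using sets_lebesgue_outer_open[OF fmeasurableD[OF Km], of "\<epsilon> / 2"] by (metis half_gt_zero)
  have mU: "measure lebesgue (U - K) < \<epsilon> / 2"
    using U(3,4) \<open>\<epsilon> > 0\<close> by (simp add: emeasure_eq_measure2 ennreal_less_iff)
  obtain d where d: "d > 0" "\<And>x y. x \<in> K \<Longrightarrow> y \<in> - U \<Longrightarrow> d \<le> dist x y"
    using separate_compact_closed[OF K, of "- U"] U(1,2) by (metis Compl_disjoint2 disjoint_eq_subset_Compl double_complement closed_Compl)
  show "\<exists>\<delta>>0. \<forall>v. norm v < \<delta> \<longrightarrow> (LINT x|lebesgue. \<bar>indicat_real K (x + v) - indicat_real K x\<bar>) < \<epsilon>"
  proof (intro exI[of _ d] conjI allI impI d(1))
    fix v :: 'a assume v: "norm v < d"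
    have sub: "x \<in> U" if "x + v \<in> K" for x
      using d(2)[OF that, of x] v by (auto simp: dist_norm)
    have iU: "integrable lebesgue (indicat_real (U - K))"
      using U(3) lmeasurable_iff_integrable by blast
    note iv = integrable_translate[OF int, of v]
    \<comment> \<open>The signed difference on the right integrates to 0 by translation invariance,
      so only twice the measure of \<open>U - K\<close> remains; this is why U was chosen with
      excess below \<epsilon>/2.\<close>
    have "(LINT x|lebesgue. \<bar>indicat_real K (x + v) - indicat_real K x\<bar>)
        \<le> (LINT x|lebesgue. 2 * indicat_real (U - K) x + (indicat_real K x - indicat_real K (x + v)))"
    proof (rule integral_mono)
      show "integrable lebesgue (\<lambda>x. \<bar>indicat_real K (x + v) - indicat_real K x\<bar>)"
        by (intro integrable_abs Bochner_Integration.integrable_diff iv int)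
      show "integrable lebesgue (\<lambda>x. 2 * indicat_real (U - K) x + (indicat_real K x - indicat_real K (x + v)))"
        by (intro Bochner_Integration.integrable_add integrable_mult_right
            Bochner_Integration.integrable_diff iv int iU)
    qed (use sub in \<open>auto simp: indicator_def\<close>)
    also have "\<dots> = 2 * measure lebesgue (U - K)"
      using int iv iU integral_translate[OF int, of v] by simp
    finally show "(LINT x|lebesgue. \<bar>indicat_real K (x + v) - indicat_real K x\<bar>) < \<epsilon>"
      using mU by simp
  qed
qed

lemma L1_translation_continuous_cmult:
  assumes "L1_translation_continuous f"
  shows "L1_translation_continuous (\<lambda>x. c * f x)"
proof (cases "c = 0")
  case True
  then show ?thesis by (auto simp: L1_translation_continuous_def intro: exI[of _ "1::real"])
next
  case False
  have f: "integrable lebesgue f" using assms by (auto simp: L1_translation_continuous_def)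
  show ?thesis unfolding L1_translation_continuous_def
  proof (intro conjI allI impI)
    fix \<epsilon> :: real assume "\<epsilon> > 0"
    then have "\<epsilon> / \<bar>c\<bar> > 0" using False by simp
    then obtain \<delta> where \<delta>: "\<delta> > 0" "\<And>v. norm v < \<delta> \<Longrightarrow> (LINT x|lebesgue. \<bar>f (x + v) - f x\<bar>) < \<epsilon> / \<bar>c\<bar>"
      using assms unfolding L1_translation_continuous_def by meson
    show "\<exists>\<delta>>0. \<forall>v. norm v < \<delta> \<longrightarrow> (LINT x|lebesgue. \<bar>c * f (x + v) - c * f x\<bar>) < \<epsilon>"
    proof (intro exI[of _ \<delta>] conjI allI impI \<delta>(1))
      fix v :: 'a assume "norm v < \<delta>"
      have "(LINT x|lebesgue. \<bar>c * f (x + v) - c * f x\<bar>) = \<bar>c\<bar> * (LINT x|lebesgue. \<bar>f (x + v) - f x\<bar>)"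
        by (simp add: abs_mult flip: right_diff_distrib)
      moreover have "\<dots> < \<epsilon>"
        using \<delta>(2)[OF \<open>norm v < \<delta>\<close>] False
          pos_less_divide_eq[of "\<bar>c\<bar>" "LINT x|lebesgue. \<bar>f (x + v) - f x\<bar>" \<epsilon>]
        by (simp add: mult.commute)
      ultimately show "(LINT x|lebesgue. \<bar>c * f (x + v) - c * f x\<bar>) < \<epsilon>" by simp
    qed
  qed (use f in simp)
qed

text \<open>Density: compact sets exhaust a set of finite measure from inside, and the class is
  stable under scalar multiples, sums and dominated limits.\<close>

lemma integrable_imp_L1_translation_continuous:
  fixes f :: "'a::euclidean_space \<Rightarrow> real"
  assumes "integrable lebesgue f"
  shows "L1_translation_continuous f"
  using assms
proof (induction rule: integrable_induct)
  case (base A c)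
  have A: "A \<in> lmeasurable" using base by (intro fmeasurableI) auto
  obtain K :: "nat \<Rightarrow> 'a set" where K: "\<And>n. compact (K n)" "\<And>n. K n \<subseteq> A"
    and lim: "AE x in lebesgue. (\<lambda>n. indicat_real (K n) x) \<longlonglongrightarrow> indicat_real A x"
    using lebesgue_compact_exhaustion[OF base(1)] by blast
  have int: "integrable lebesgue (indicat_real A)"
    using A lmeasurable_iff_integrable by blast
  have Km: "K n \<in> sets lebesgue" for n by (rule fmeasurableD[OF lmeasurable_compact[OF K(1)]])
  have "L1_translation_continuous (indicat_real A)"
  proof (rule L1_translation_continuous_approx[OF int L1_translation_continuous_compact[OF K(1)]])
    have "(\<lambda>n. LINT x|lebesgue. \<bar>indicat_real A x - indicat_real (K n) x\<bar>) \<longlonglongrightarrow> integral\<^sup>L lebesgue (\<lambda>x::'a. 0)"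
    proof (rule integral_dominated_convergence[where w="indicat_real A"])
      show "(\<lambda>x. \<bar>indicat_real A x - indicat_real (K n) x\<bar>) \<in> borel_measurable lebesgue" for n
        using base(1) Km[of n] by measurable
      show "AE x in lebesgue. (\<lambda>n. \<bar>indicat_real A x - indicat_real (K n) x\<bar>) \<longlonglongrightarrow> 0"
        using lim
      proof eventually_elim
        case (elim x)
        then show ?case using tendsto_rabs[OF tendsto_diff[OF tendsto_const elim, of "indicat_real A x"]] by simp
      qed
      show "AE x in lebesgue. norm \<bar>indicat_real A x - indicat_real (K n) x\<bar> \<le> indicat_real A x" for n
        using K(2)[of n] by (auto simp: indicator_def)
    qed (use int in auto)
    then show "(\<lambda>n. LINT x|lebesgue. \<bar>indicat_real A x - indicat_real (K n) x\<bar>) \<longlonglongrightarrow> 0" by simp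
  qed
  from L1_translation_continuous_cmult[OF this, of c] show ?case by (simp add: mult.commute)
next
  case (add f g)
  show ?case unfolding L1_translation_continuous_def
  proof (intro conjI allI impI)
    fix \<epsilon> :: real assume "\<epsilon> > 0"
    then have \<epsilon>2: "\<epsilon> / 2 > 0" by simp
    obtain a where a: "a > 0" "\<And>v. norm v < a \<Longrightarrow> (LINT x|lebesgue. \<bar>f (x + v) - f x\<bar>) < \<epsilon> / 2"
      using add(3) \<epsilon>2 unfolding L1_translation_continuous_def by meson
    obtain b where b: "b > 0" "\<And>v. norm v < b \<Longrightarrow> (LINT x|lebesgue. \<bar>g (x + v) - g x\<bar>) < \<epsilon> / 2"
      using add(4) \<epsilon>2 unfolding L1_translation_continuous_def by meson
    show "\<exists>\<delta>>0. \<forall>v. norm v < \<delta> \<longrightarrow> (LINT x|lebesgue. \<bar>f (x + v) + g (x + v) - (f x + g x)\<bar>) < \<epsilon>"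
    proof (intro exI[of _ "min a b"] conjI allI impI)
      fix v :: 'a assume v: "norm v < min a b"
      note [simp] = add(1,2) integrable_translate[OF add(1)] integrable_translate[OF add(2)]
      have "(LINT x|lebesgue. \<bar>f (x + v) + g (x + v) - (f x + g x)\<bar>)
          \<le> (LINT x|lebesgue. \<bar>f (x + v) - f x\<bar> + \<bar>g (x + v) - g x\<bar>)"
        by (intro integral_mono) auto
      also have "\<dots> = (LINT x|lebesgue. \<bar>f (x + v) - f x\<bar>) + (LINT x|lebesgue. \<bar>g (x + v) - g x\<bar>)"
        by simp
      finally show "(LINT x|lebesgue. \<bar>f (x + v) + g (x + v) - (f x + g x)\<bar>) < \<epsilon>"
        using a(2)[of v] b(2)[of v] v by simp
    qed (use a b in auto)
  qed (use add in auto)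
next
  case (lim f s)
  show ?case
  proof (rule L1_translation_continuous_approx[OF lim(4) lim(5)])
    \<comment> \<open>The factor is 3 = 1 + 2: the induction rule supplies approximations with |s n|
      \<le> 2 |f|.\<close>
    have "(\<lambda>n. LINT x|lebesgue. \<bar>f x - s n x\<bar>) \<longlonglongrightarrow> integral\<^sup>L lebesgue (\<lambda>x::'a. 0)"
    proof (rule integral_dominated_convergence[where w="\<lambda>x. 3 * \<bar>f x\<bar>"])
      show "(\<lambda>x. \<bar>f x - s n x\<bar>) \<in> borel_measurable lebesgue" for n
        using lim(1)[of n] lim(4) by measurable
      show "AE x in lebesgue. (\<lambda>n. \<bar>f x - s n x\<bar>) \<longlonglongrightarrow> 0"
      proof (rule AE_I2)
        fix x :: 'a assume "x \<in> space lebesgue"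
        from tendsto_rabs[OF tendsto_diff[OF tendsto_const lim(2)[OF this], of "f x"]]
        show "(\<lambda>n. \<bar>f x - s n x\<bar>) \<longlonglongrightarrow> 0" by simp
      qed
      show "AE x in lebesgue. norm \<bar>f x - s n x\<bar> \<le> 3 * \<bar>f x\<bar>" for n
      proof (rule AE_I2)
        fix x :: 'a assume "x \<in> space lebesgue"
        from lim(3)[OF this, of n] show "norm \<bar>f x - s n x\<bar> \<le> 3 * \<bar>f x\<bar>" by simp
      qed
    qed (use lim(4) in auto)
    then show "(\<lambda>n. LINT x|lebesgue. \<bar>f x - s n x\<bar>) \<longlonglongrightarrow> 0" by simp
  qed
qed

subsection \<open>Difference quotients of weakly differentiable functions\<close>

lemma integral_translate_test:
  assumes "integrable lebesgue f" "\<phi> \<in> test_functions U"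
  shows "(LINT x|lebesgue. f x * \<phi> (x - v)) = (LINT x|lebesgue. f (x + v) * \<phi> x)"
  using integral_translate[OF integrable_mult_test[OF assms(1) test_function_translate[OF assms(2), of v UNIV]], of v]
  by simp

text \<open>As f is only integrable, the shift is put on the smooth factor. The Lipschitz constant L
  of \<phi> along e bounds its difference quotients, so \<open>L * \<bar>f x\<bar>\<close>
  dominates.\<close>

lemma has_derivative_integral_test:
  fixes f :: "'a::euclidean_space \<Rightarrow> real"
  assumes f: "integrable lebesgue f" and \<phi>: "\<phi> \<in> test_functions U"
  shows "((\<lambda>t. LINT x|lebesgue. f x * \<phi> (x - t *\<^sub>R e)) has_real_derivative
     - (LINT x|lebesgue. f x * frechet_derivative \<phi> (at (x - t *\<^sub>R e)) e)) (at t)"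
proof -
  have tr: "(\<lambda>x. \<phi> (x - s *\<^sub>R e)) \<in> test_functions UNIV" for s
    by (rule test_function_translate[OF \<phi>]) simp
  have trd: "(\<lambda>x. frechet_derivative \<phi> (at (x - s *\<^sub>R e)) e) \<in> test_functions UNIV" for s
    by (rule test_function_translate[OF test_function_directional_deriv[OF \<phi>]]) simp
  note int = integrable_mult_test[OF f tr]
  obtain L where L: "L > 0" "\<And>x s t. \<bar>\<phi> (x - t *\<^sub>R e) - \<phi> (x - s *\<^sub>R e)\<bar> \<le> L * \<bar>t - s\<bar>"
    using test_function_Lipschitz[OF \<phi>, of e] by metis
  have "((\<lambda>s. ((LINT x|lebesgue. f x * \<phi> (x - s *\<^sub>R e)) - (LINT x|lebesgue. f x * \<phi> (x - t *\<^sub>R e))) / (s - t))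
      \<longlongrightarrow> (LINT x|lebesgue. f x * - frechet_derivative \<phi> (at (x - t *\<^sub>R e)) e)) (at t)"
    unfolding tendsto_at_iff_sequentially comp_def
  proof (intro allI impI)
    fix X :: "nat \<Rightarrow> real" assume X: "\<forall>i. X i \<in> UNIV - {t}" "X \<longlonglongrightarrow> t"
    let ?q = "\<lambda>n x. f x * ((\<phi> (x - X n *\<^sub>R e) - \<phi> (x - t *\<^sub>R e)) / (X n - t))"
    have "(\<lambda>n. LINT x|lebesgue. ?q n x) \<longlonglongrightarrow> (LINT x|lebesgue. f x * - frechet_derivative \<phi> (at (x - t *\<^sub>R e)) e)"
    proof (rule integral_dominated_convergence[where w="\<lambda>x. L * \<bar>f x\<bar>"])
      show "(\<lambda>x. f x * - frechet_derivative \<phi> (at (x - t *\<^sub>R e)) e) \<in> borel_measurable lebesgue"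
        using f test_function_measurable[OF trd] by measurable
      show "?q n \<in> borel_measurable lebesgue" for n
        using f test_function_measurable[OF tr, of "X n"] test_function_measurable[OF tr, of t] by measurable
      show "AE x in lebesgue. (\<lambda>n. ?q n x) \<longlonglongrightarrow> f x * - frechet_derivative \<phi> (at (x - t *\<^sub>R e)) e"
      proof (intro AE_I2 tendsto_mult_left)
        fix x
        show "(\<lambda>n. (\<phi> (x - X n *\<^sub>R e) - \<phi> (x - t *\<^sub>R e)) / (X n - t)) \<longlonglongrightarrow> - frechet_derivative \<phi> (at (x - t *\<^sub>R e)) e"
          using test_function_has_real_derivative[OF \<phi>, of x e t] X
          unfolding has_field_derivative_iff tendsto_at_iff_sequentially comp_def by blast
      qed
      show "AE x in lebesgue. norm (?q n x) \<le> L * \<bar>f x\<bar>" for n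
      proof (rule AE_I2)
        fix x
        have "X n \<noteq> t" using X(1) by auto
        then have "\<bar>(\<phi> (x - X n *\<^sub>R e) - \<phi> (x - t *\<^sub>R e)) / (X n - t)\<bar> \<le> L"
          using L(2)[of x "X n" t] by (simp add: pos_divide_le_eq)
        from mult_right_mono[OF this, of "\<bar>f x\<bar>"]
        show "norm (?q n x) \<le> L * \<bar>f x\<bar>" by (simp add: abs_mult mult.commute)
      qed
    qed (use f in auto)
    moreover have "(LINT x|lebesgue. ?q n x) =
        ((LINT x|lebesgue. f x * \<phi> (x - X n *\<^sub>R e)) - (LINT x|lebesgue. f x * \<phi> (x - t *\<^sub>R e))) / (X n - t)" for n
      using int[of "X n"] int[of t]
      by (simp add: diff_divide_distrib right_diff_distrib)
    ultimately show "(\<lambda>n. ((LINT x|lebesgue. f x * \<phi> (x - X n *\<^sub>R e)) - (LINT x|lebesgue. f x * \<phi> (x - t *\<^sub>R e))) / (X n - t))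
      \<longlonglongrightarrow> (LINT x|lebesgue. f x * - frechet_derivative \<phi> (at (x - t *\<^sub>R e)) e)"
      by (simp only:)
  qed
  then show ?thesis unfolding has_field_derivative_iff by simp
qed

text \<open>Against a test function \<open>\<psi>\<close>, \<open>t \<mapsto> \<integral> f(x) \<psi>(x - te) dx\<close> has derivative
  \<open>\<integral> g(x + te) \<psi>(x) dx\<close>, so the mean value theorem compares the difference quotient with \<open>g\<close>.\<close>

lemma difference_quotient_estimate:
  fixes f g :: "'a::euclidean_space \<Rightarrow> real"
  assumes f: "integrable lebesgue f" and g: "integrable lebesgue g"
    and weak: "\<And>\<phi>. \<phi> \<in> test_functions U \<Longrightarrow>
      (LINT x|lebesgue. f x * frechet_derivative \<phi> (at x) e) = - (LINT x|lebesgue. g x * \<phi> x)"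
    and V: "open V" and h: "h > 0" and VU: "\<And>x t. x \<in> V \<Longrightarrow> 0 \<le> t \<Longrightarrow> t \<le> h \<Longrightarrow> x + t *\<^sub>R e \<in> U"
    and c: "\<And>t. 0 \<le> t \<Longrightarrow> t \<le> h \<Longrightarrow> (LINT x|lebesgue. \<bar>g (x + t *\<^sub>R e) - g x\<bar>) \<le> c"
  shows "(LINT x|lebesgue. \<bar>(f (x + h *\<^sub>R e) - f x) / h - g x\<bar> * indicator V x) \<le> 2 * c"
proof (rule test_bound[OF _ V])
  note fh = integrable_translate[OF f, of "h *\<^sub>R e"]
  show "integrable lebesgue (\<lambda>x. (f (x + h *\<^sub>R e) - f x) / h - g x)"
    using f fh g by simp
  fix \<psi> :: "'a \<Rightarrow> real" assume \<psi>: "\<psi> \<in> test_functions V" and \<psi>01: "\<And>x. 0 \<le> \<psi> x \<and> \<psi> x \<le> 1"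
  let ?m = "\<lambda>t. LINT x|lebesgue. f x * \<psi> (x - t *\<^sub>R e)"
  let ?G = "LINT x|lebesgue. g x * \<psi> x"
  \<comment> \<open>Subtracting the linear term \<open>t * ?G\<close> leaves as derivative the
    pairing with g(x + te) - g(x), which is at most c; over [0, h] the function changes by at most c
    h.\<close>
  have der: "((\<lambda>t. ?m t - t * ?G) has_real_derivative
      (LINT x|lebesgue. (g (x + t *\<^sub>R e) - g x) * \<psi> x)) (at t within {0..h})" if "t \<in> {0..h}" for t
  proof -
    \<comment> \<open>The support moves by +te and so stays in U, where the weak identity is
      available.\<close>
    have tr: "(\<lambda>x. \<psi> (x - t *\<^sub>R e)) \<in> test_functions U"
      by (rule test_function_translate[OF \<psi>]) (use VU that in auto)
    have "- (LINT x|lebesgue. f x * frechet_derivative \<psi> (at (x - t *\<^sub>R e)) e) =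
        (LINT x|lebesgue. g x * \<psi> (x - t *\<^sub>R e))"
      using weak[OF tr] by (simp add: frechet_derivative_translate[OF \<psi>])
    also have "\<dots> = (LINT x|lebesgue. g (x + t *\<^sub>R e) * \<psi> x)"
      by (rule integral_translate_test[OF g \<psi>])
    finally have "(?m has_real_derivative (LINT x|lebesgue. g (x + t *\<^sub>R e) * \<psi> x)) (at t)"
      using has_derivative_integral_test[OF f \<psi>, of e t] by simp
    then have "((\<lambda>t. ?m t - t * ?G) has_real_derivative (LINT x|lebesgue. g (x + t *\<^sub>R e) * \<psi> x) - ?G) (at t)"
      by (auto intro!: derivative_eq_intros)
    moreover have "(LINT x|lebesgue. g (x + t *\<^sub>R e) * \<psi> x) - ?G = (LINT x|lebesgue. (g (x + t *\<^sub>R e) - g x) * \<psi> x)"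
      using integrable_mult_test[OF integrable_translate[OF g, of "t *\<^sub>R e"] \<psi>] integrable_mult_test[OF g \<psi>]
      by (simp add: left_diff_distrib)
    ultimately show ?thesis by (simp add: has_field_derivative_at_within)
  qed
  have bd: "norm (LINT x|lebesgue. (g (x + t *\<^sub>R e) - g x) * \<psi> x) \<le> c" if "t \<in> {0..h}" for t
  proof -
    have i: "integrable lebesgue (\<lambda>x. g (x + t *\<^sub>R e) - g x)"
      using g integrable_translate[OF g] by simp
    have "norm (LINT x|lebesgue. (g (x + t *\<^sub>R e) - g x) * \<psi> x) \<le>
        (LINT x|lebesgue. norm ((g (x + t *\<^sub>R e) - g x) * \<psi> x))"
      by (rule integral_norm_bound)
    also have "\<dots> \<le> (LINT x|lebesgue. \<bar>g (x + t *\<^sub>R e) - g x\<bar>)"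
    proof (rule integral_mono)
      show "norm ((g (x + t *\<^sub>R e) - g x) * \<psi> x) \<le> \<bar>g (x + t *\<^sub>R e) - g x\<bar>" for x
        using \<psi>01[of x] by (simp add: abs_mult mult_left_le)
    qed (use i integrable_mult_test[OF i \<psi>] in auto)
    also have "\<dots> \<le> c" using c that by auto
    finally show ?thesis .
  qed
  have "norm ((?m h - h * ?G) - (?m 0 - 0 * ?G)) \<le> c * norm (h - 0)"
    by (rule field_differentiable_bound[OF _ der bd]) (use h in auto)
  moreover have "(?m h - h * ?G) - (?m 0 - 0 * ?G) =
      h * (LINT x|lebesgue. ((f (x + h *\<^sub>R e) - f x) / h - g x) * \<psi> x)"
  proof -
    have "?m h = (LINT x|lebesgue. f (x + h *\<^sub>R e) * \<psi> x)"
      by (rule integral_translate_test[OF f \<psi>])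
    moreover have "h * (LINT x|lebesgue. ((f (x + h *\<^sub>R e) - f x) / h - g x) * \<psi> x) =
        (LINT x|lebesgue. f (x + h *\<^sub>R e) * \<psi> x - f x * \<psi> x - h * (g x * \<psi> x))"
      using h by (subst Bochner_Integration.integral_mult_right_zero[symmetric])
        (intro Bochner_Integration.integral_cong refl, simp add: field_simps)
    ultimately show ?thesis
      using integrable_mult_test[OF f \<psi>] integrable_mult_test[OF g \<psi>] integrable_mult_test[OF fh \<psi>]
      by simp
  qed
  ultimately show "\<bar>LINT x|lebesgue. ((f (x + h *\<^sub>R e) - f x) / h - g x) * \<psi> x\<bar> \<le> c"
    using h by (simp add: abs_mult mult.commute)
qed

text \<open>Continuity of translations of g in L1 supplies the constant for
  \<open>difference_quotient_estimate\<close>, and eventually \<open>h n < d\<close>, so that the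
  shifts of V stay inside U.\<close>

lemma difference_quotient_L1:
  fixes f g :: "'a::euclidean_space \<Rightarrow> real"
  assumes f: "integrable lebesgue f" and g: "integrable lebesgue g"
    and weak: "\<And>\<phi>. \<phi> \<in> test_functions U \<Longrightarrow>
      (LINT x|lebesgue. f x * frechet_derivative \<phi> (at x) e) = - (LINT x|lebesgue. g x * \<phi> x)"
    and V: "open V" and d: "d > 0" and VU: "\<And>x t. x \<in> V \<Longrightarrow> 0 \<le> t \<Longrightarrow> t \<le> d \<Longrightarrow> x + t *\<^sub>R e \<in> U"
    and h: "\<And>n::nat. h n > 0" "h \<longlonglongrightarrow> 0"
  shows "(\<lambda>n. LINT x|lebesgue. \<bar>(f (x + h n *\<^sub>R e) - f x) / h n - g x\<bar> * indicator V x) \<longlonglongrightarrow> 0"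
proof (rule tendstoI)
  fix \<epsilon> :: real assume "\<epsilon> > 0"
  then have "\<epsilon> / 4 > 0" by simp
  then obtain \<delta> where \<delta>: "\<delta> > 0" "\<And>v. norm v < \<delta> \<Longrightarrow> (LINT x|lebesgue. \<bar>g (x + v) - g x\<bar>) < \<epsilon> / 4"
    using integrable_imp_L1_translation_continuous[OF g] unfolding L1_translation_continuous_def by meson
  have "(\<lambda>n. h n * norm e) \<longlonglongrightarrow> 0" using tendsto_mult_left_zero[OF h(2)] by simp
  then have "\<forall>\<^sub>F n in sequentially. h n * norm e < \<delta>"
    using \<delta>(1) by (rule order_tendstoD)
  moreover have "\<forall>\<^sub>F n in sequentially. h n < d"
    using h(2) d by (rule order_tendstoD)
  ultimately show "\<forall>\<^sub>F n in sequentially.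
    dist (LINT x|lebesgue. \<bar>(f (x + h n *\<^sub>R e) - f x) / h n - g x\<bar> * indicator V x) 0 < \<epsilon>"
  proof eventually_elim
    case (elim n)
    have "(LINT x|lebesgue. \<bar>g (x + t *\<^sub>R e) - g x\<bar>) \<le> \<epsilon> / 4" if "0 \<le> t" "t \<le> h n" for t
    proof -
      have "norm (t *\<^sub>R e) \<le> h n * norm e" using that by (simp add: mult_right_mono)
      with elim(1) show ?thesis by (intro less_imp_le \<delta>(2)) linarith
    qed
    from difference_quotient_estimate[OF f g weak V h(1) VU this, of n] elim(2)
    have "(LINT x|lebesgue. \<bar>(f (x + h n *\<^sub>R e) - f x) / h n - g x\<bar> * indicator V x) \<le> 2 * (\<epsilon> / 4)"
      by force
    moreover have "0 \<le> (LINT x|lebesgue. \<bar>(f (x + h n *\<^sub>R e) - f x) / h n - g x\<bar> * indicator V x)"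
      by (intro Bochner_Integration.integral_nonneg) auto
    ultimately show ?case using \<open>\<epsilon> > 0\<close> by simp
  qed
qed

subsection \<open>The positive part\<close>

text \<open>Away from y = 0 the sign of \<open>a n\<close> is eventually that of y. At y = 0 the
  quotient is the positive part of \<open>(a n - y) / h n\<close>, because \<open>h n > 0\<close>;
  the value \<open>max 0 c\<close> is a one-sided derivative.\<close>

lemma tendsto_max_0_quotient:
  fixes y c :: real and a h :: "nat \<Rightarrow> real"
  assumes h: "\<And>n. h n > 0" "h \<longlonglongrightarrow> 0" and lim: "(\<lambda>n. (a n - y) / h n) \<longlonglongrightarrow> c"
  shows "(\<lambda>n. (max 0 (a n) - max 0 y) / h n) \<longlonglongrightarrow> (if y > 0 then c else if y = 0 then max 0 c else 0)"
proof -
  have "(\<lambda>n. h n * ((a n - y) / h n)) \<longlonglongrightarrow> 0 * c"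
    by (intro tendsto_mult h lim)
  moreover have "h n * ((a n - y) / h n) = a n - y" for n using h(1)[of n] by simp
  ultimately have "(\<lambda>n. a n - y + y) \<longlonglongrightarrow> 0 + y" by (intro tendsto_add) auto
  then have a: "a \<longlonglongrightarrow> y" by simp
  consider "y > 0" | "y = 0" | "y < 0" by linarith
  then show ?thesis
  proof cases
    case 1
    have "\<forall>\<^sub>F n in sequentially. (a n - y) / h n = (max 0 (a n) - max 0 y) / h n"
      using order_tendstoD(1)[OF a 1] by eventually_elim (use 1 in simp)
    from Lim_transform_eventually[OF lim this] 1 show ?thesis by simp
  next
    case 2
    have "max 0 ((a n - y) / h n) = (max 0 (a n) - max 0 y) / h n" for n
      using h(1)[of n] 2 by (auto simp: max_def divide_le_0_iff zero_le_divide_iff)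
    with tendsto_max[OF tendsto_const lim, of 0] 2 show ?thesis by simp
  next
    case 3
    have "\<forall>\<^sub>F n in sequentially. 0 = (max 0 (a n) - max 0 y) / h n"
      using order_tendstoD(2)[OF a 3] by eventually_elim (use 3 in simp)
    from Lim_transform_eventually[OF tendsto_const this] 3 show ?thesis by simp
  qed
qed

text \<open>A test function is bounded and vanishes off V, so an error that is small in L1 on V
  alone is harmless in pairings.\<close>

lemma tendsto_integral_mult_test:
  fixes F G :: "nat \<Rightarrow> 'a::euclidean_space \<Rightarrow> real"
  assumes int: "\<And>n. integrable lebesgue (F n)" "\<And>n. integrable lebesgue (G n)"
    and V: "V \<in> sets lebesgue" and \<phi>: "\<phi> \<in> test_functions V"
    and le: "\<And>n. integrable lebesgue (E n)" "\<And>n x. \<bar>F n x - G n x\<bar> \<le> E n x"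
    and E: "(\<lambda>n. LINT x|lebesgue. E n x * indicator V x) \<longlonglongrightarrow> 0"
  shows "(\<lambda>n. (LINT x|lebesgue. F n x * \<phi> x) - (LINT x|lebesgue. G n x * \<phi> x)) \<longlonglongrightarrow> 0"
proof -
  obtain B where B: "B > 0" "\<And>x. \<bar>\<phi> x\<bar> \<le> B" using test_function_bounded[OF \<phi>] by metis
  have bd: "\<bar>(LINT x|lebesgue. F n x * \<phi> x) - (LINT x|lebesgue. G n x * \<phi> x)\<bar>
      \<le> B * (LINT x|lebesgue. E n x * indicator V x)" for n
  proof -
    have i: "integrable lebesgue (\<lambda>x. (F n x - G n x) * \<phi> x)"
      using int \<phi> by (intro integrable_mult_test) auto
    have iE: "integrable lebesgue (\<lambda>x. E n x * indicator V x)"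
      by (rule integrable_real_mult_indicator[OF V le(1)])
    have "(LINT x|lebesgue. F n x * \<phi> x) - (LINT x|lebesgue. G n x * \<phi> x) = (LINT x|lebesgue. (F n x - G n x) * \<phi> x)"
      using integrable_mult_test[OF int(1) \<phi>] integrable_mult_test[OF int(2) \<phi>]
      by (simp add: left_diff_distrib)
    then have "\<bar>(LINT x|lebesgue. F n x * \<phi> x) - (LINT x|lebesgue. G n x * \<phi> x)\<bar>
        \<le> (LINT x|lebesgue. norm ((F n x - G n x) * \<phi> x))"
      using integral_norm_bound[of lebesgue "\<lambda>x. (F n x - G n x) * \<phi> x"] by simp
    also have "\<dots> \<le> (LINT x|lebesgue. B * (E n x * indicator V x))"
    proof (rule integral_mono)
      fix x
      show "norm ((F n x - G n x) * \<phi> x) \<le> B * (E n x * indicator V x)"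
      proof (cases "x \<in> V")
        case True
        have "\<bar>F n x - G n x\<bar> * \<bar>\<phi> x\<bar> \<le> E n x * B"
          using le(2)[of n x] B(2)[of x] by (intro mult_mono) auto
        then show ?thesis using True by (simp add: abs_mult mult.commute)
      next
        case False
        then show ?thesis using test_function_off_set(1)[OF \<phi>] by simp
      qed
    qed (use i iE in auto)
    finally show ?thesis by simp
  qed
  have "(\<lambda>n. B * (LINT x|lebesgue. E n x * indicator V x)) \<longlonglongrightarrow> 0"
    by (rule tendsto_mult_right_zero[OF E])
  then show ?thesis
  proof (rule Lim_null_comparison[OF always_eventually, rotated], intro allI)
    fix n
    show "norm ((LINT x|lebesgue. F n x * \<phi> x) - (LINT x|lebesgue. G n x * \<phi> x))
        \<le> B * (LINT x|lebesgue. E n x * indicator V x)"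
      using bd[of n] by (simp only: real_norm_def)
  qed
qed

text \<open>The pairings of the difference quotients of \<open>max 0 f\<close> with \<phi> are
  computed twice: pointwise limits and domination give the right side, moving the shift to \<phi>
  gives the left. Only positive steps occur, which leaves the one-sided value
  \<open>max 0 (g x)\<close> on \<open>{f = 0}\<close>.\<close>

lemma weak_derivative_max_0_one_sided:
  fixes f g :: "'a::euclidean_space \<Rightarrow> real"
  assumes f: "integrable lebesgue f" and g: "integrable lebesgue g"
    and weak: "\<And>\<phi>. \<phi> \<in> test_functions U \<Longrightarrow>
      (LINT x|lebesgue. f x * frechet_derivative \<phi> (at x) e) = - (LINT x|lebesgue. g x * \<phi> x)"
    and V: "open V" and d: "d > 0" and VU: "\<And>x t. x \<in> V \<Longrightarrow> 0 \<le> t \<Longrightarrow> t \<le> d \<Longrightarrow> x + t *\<^sub>R e \<in> U"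
    and \<phi>: "\<phi> \<in> test_functions V"
  shows "(LINT x|lebesgue. max 0 (f x) * frechet_derivative \<phi> (at x) e) =
    - (LINT x|lebesgue. (if f x > 0 then g x else if f x = 0 then max 0 (g x) else 0) * \<phi> x)"
    (is "_ = - (LINT x|lebesgue. ?L x * _)")
proof -
  define h where "h n = 1 / real (Suc n)" for n
  have h: "h n > 0" "h \<longlonglongrightarrow> 0" for n
    by (simp add: h_def) (unfold h_def, rule LIMSEQ_Suc[OF lim_1_over_n])
  have Vm: "V \<in> sets lebesgue" using V by simp
  define D where "D n x = (f (x + h n *\<^sub>R e) - f x) / h n" for n x
  define P where "P n x = (max 0 (f (x + h n *\<^sub>R e)) - max 0 (f x)) / h n" for n x
  have fp: "integrable lebesgue (\<lambda>x. max 0 (f x))" using f by simp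
  have Di: "integrable lebesgue (D n)" for n
    unfolding D_def using f integrable_translate[OF f] by simp
  have Pi: "integrable lebesgue (P n)" for n
    unfolding P_def using fp integrable_translate[OF fp] by simp
  have L1: "(\<lambda>n. LINT x|lebesgue. \<bar>D n x - g x\<bar> * indicator V x) \<longlonglongrightarrow> 0"
    unfolding D_def by (rule difference_quotient_L1[OF f g weak V d VU h])
  have int: "integrable lebesgue (\<lambda>x. \<bar>D n x - g x\<bar> * indicator V x)" for n
    by (rule integrable_real_mult_indicator[OF Vm integrable_abs[OF Bochner_Integration.integrable_diff[OF Di g]]])
  \<comment> \<open>L1 convergence yields pointwise convergence almost everywhere only along a
    subsequence. That suffices, since neither side of the claim involves the sequence.\<close>
  obtain r :: "nat \<Rightarrow> nat" where r: "strict_mono r"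
    and AE: "AE x in lebesgue. (\<lambda>n. \<bar>D (r n) x - g x\<bar> * indicator V x) \<longlonglongrightarrow> 0"
    using tendsto_L1_AE_subseq[where u="\<lambda>n x. \<bar>D n x - g x\<bar> * indicator V x", OF int] L1 by auto
  have hr: "h (r n) > 0" "(\<lambda>n. h (r n)) \<longlonglongrightarrow> 0" for n
    using h(1) LIMSEQ_subseq_LIMSEQ[OF h(2) r] by (auto simp: comp_def)
  text \<open>\<open>P n\<close> is truncated at \<open>\<bar>g\<bar>\<close> in order to be dominated; the error is at most \<open>\<bar>D n - g\<bar>\<close>,
    because \<open>\<bar>P n\<bar> \<le> \<bar>D n\<bar>\<close>.\<close>
  define T where "T n x = max (- \<bar>g x\<bar>) (min \<bar>g x\<bar> (P n x))" for n x
  have Ti: "integrable lebesgue (T n)" for n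
    unfolding T_def using g Pi by auto
  have PT: "\<bar>P n x - T n x\<bar> \<le> \<bar>D n x - g x\<bar>" for n x
  proof -
    have "\<bar>max 0 (f (x + h n *\<^sub>R e)) - max 0 (f x)\<bar> \<le> \<bar>f (x + h n *\<^sub>R e) - f x\<bar>" by auto
    then have "\<bar>P n x\<bar> \<le> \<bar>D n x\<bar>"
      unfolding P_def D_def using h(1)[of n] by (simp add: divide_right_mono)
    then show ?thesis unfolding T_def by (auto simp: max_def min_def)
  qed
  have lim1: "(\<lambda>n. (LINT x|lebesgue. P n x * \<phi> x) - (LINT x|lebesgue. T n x * \<phi> x)) \<longlonglongrightarrow> 0"
    by (rule tendsto_integral_mult_test[OF Pi Ti Vm \<phi> _ PT L1]) (use Di g in auto)
  have gm[measurable]: "g \<in> borel_measurable lebesgue" and fm[measurable]: "f \<in> borel_measurable lebesgue"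
    using f g by auto
  have Lm: "?L \<in> borel_measurable lebesgue" by measurable
  obtain B where B: "B > 0" "\<And>x. \<bar>\<phi> x\<bar> \<le> B" using test_function_bounded[OF \<phi>] by metis
  have lim2: "(\<lambda>n. LINT x|lebesgue. T (r n) x * \<phi> x) \<longlonglongrightarrow> (LINT x|lebesgue. ?L x * \<phi> x)"
  proof (rule integral_dominated_convergence[where w="\<lambda>x. \<bar>g x\<bar> * B"])
    show "(\<lambda>x. ?L x * \<phi> x) \<in> borel_measurable lebesgue"
      using Lm test_function_measurable[OF \<phi>] by measurable
    show "(\<lambda>x. T (r n) x * \<phi> x) \<in> borel_measurable lebesgue" for n
      using integrable_mult_test[OF Ti \<phi>] by simp
    show "AE x in lebesgue. (\<lambda>n. T (r n) x * \<phi> x) \<longlonglongrightarrow> ?L x * \<phi> x"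
      using AE
    proof eventually_elim
      case (elim x)
      show ?case
      proof (cases "x \<in> V")
        case True
        then have "(\<lambda>n. D (r n) x - g x) \<longlonglongrightarrow> 0"
          using elim by (simp add: tendsto_rabs_zero_iff)
        then have "(\<lambda>n. D (r n) x) \<longlonglongrightarrow> g x" by (simp add: LIM_zero_iff)
        then have "(\<lambda>n. P (r n) x) \<longlonglongrightarrow> ?L x"
          unfolding P_def D_def by (rule tendsto_max_0_quotient[OF hr])
        then have "(\<lambda>n. T (r n) x) \<longlonglongrightarrow> max (- \<bar>g x\<bar>) (min \<bar>g x\<bar> (?L x))"
          unfolding T_def by (intro tendsto_max tendsto_min tendsto_const)
        moreover have "max (- \<bar>g x\<bar>) (min \<bar>g x\<bar> (?L x)) = ?L x"
          by (auto simp: max_def min_def)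
        ultimately show ?thesis by (intro tendsto_mult_right) simp
      next
        case False
        then show ?thesis using test_function_off_set(1)[OF \<phi>] by simp
      qed
    qed
    show "AE x in lebesgue. norm (T (r n) x * \<phi> x) \<le> \<bar>g x\<bar> * B" for n
    proof (rule AE_I2)
      fix x
      have "\<bar>T (r n) x\<bar> \<le> \<bar>g x\<bar>" unfolding T_def by (auto simp: max_def min_def)
      then show "norm (T (r n) x * \<phi> x) \<le> \<bar>g x\<bar> * B"
        using B(2)[of x] by (simp add: abs_mult mult_mono)
    qed
  qed (use g in auto)
  have lim3: "(\<lambda>n. LINT x|lebesgue. P (r n) x * \<phi> x) \<longlonglongrightarrow> (LINT x|lebesgue. ?L x * \<phi> x)"
    using tendsto_add[OF LIMSEQ_subseq_LIMSEQ[OF lim1 r] lim2] by (simp add: comp_def)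
  \<comment> \<open>Discrete integration by parts: by translation invariance the pairing of
    \<open>P (r n)\<close> with \<phi> is the difference quotient of \<open>?m\<close> at 0, in
    which \<phi> carries the shift.\<close>
  let ?m = "\<lambda>t. LINT x|lebesgue. max 0 (f x) * \<phi> (x - t *\<^sub>R e)"
  have "((\<lambda>t. (?m t - ?m 0) / (t - 0)) \<longlongrightarrow> - (LINT x|lebesgue. max 0 (f x) * frechet_derivative \<phi> (at x) e)) (at 0)"
    using has_derivative_integral_test[OF fp \<phi>, of e 0] by (simp add: has_field_derivative_iff)
  moreover have "filterlim (\<lambda>n. h (r n)) (at 0) sequentially"
    using hr by (auto simp: filterlim_at less_imp_neq[symmetric] intro!: always_eventually)
  ultimately have "(\<lambda>n. (?m (h (r n)) - ?m 0) / (h (r n) - 0)) \<longlonglongrightarrow> - (LINT x|lebesgue. max 0 (f x) * frechet_derivative \<phi> (at x) e)"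
    by (rule filterlim_compose)
  moreover have "(?m (h (r n)) - ?m 0) / (h (r n) - 0) = (LINT x|lebesgue. P (r n) x * \<phi> x)" for n
  proof -
    have "(LINT x|lebesgue. P (r n) x * \<phi> x) =
        (LINT x|lebesgue. (max 0 (f (x + h (r n) *\<^sub>R e)) * \<phi> x - max 0 (f x) * \<phi> x) / h (r n))"
      by (intro Bochner_Integration.integral_cong) (auto simp: P_def left_diff_distrib)
    then show ?thesis
      using integral_translate_test[OF fp \<phi>, of "h (r n) *\<^sub>R e"]
        integrable_mult_test[OF fp \<phi>] integrable_mult_test[OF integrable_translate[OF fp, of "h (r n) *\<^sub>R e"] \<phi>]
      by simp
  qed
  ultimately have "(\<lambda>n. LINT x|lebesgue. P (r n) x * \<phi> x) \<longlonglongrightarrow> - (LINT x|lebesgue. max 0 (f x) * frechet_derivative \<phi> (at x) e)"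
    by (simp only:)
  from LIMSEQ_unique[OF this lim3] show ?thesis by simp
qed

text \<open>Comparing the directions \<open>e\<close> and \<open>-e\<close> shows that \<open>g\<close> vanishes almost everywhere on
  \<open>{f = 0}\<close>.\<close>

lemma weak_derivative_max_0:
  fixes f g :: "'a::euclidean_space \<Rightarrow> real"
  assumes f: "integrable lebesgue f" and g: "integrable lebesgue g"
    and weak: "\<And>\<phi>. \<phi> \<in> test_functions U \<Longrightarrow>
      (LINT x|lebesgue. f x * frechet_derivative \<phi> (at x) e) = - (LINT x|lebesgue. g x * \<phi> x)"
    and V: "open V" and d: "d > 0" and VU: "\<And>x t. x \<in> V \<Longrightarrow> \<bar>t\<bar> \<le> d \<Longrightarrow> x + t *\<^sub>R e \<in> U"
    and \<phi>: "\<phi> \<in> test_functions V"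
  shows "(LINT x|lebesgue. max 0 (f x) * frechet_derivative \<phi> (at x) e) =
    - (LINT x|lebesgue. (if f x > 0 then g x else 0) * \<phi> x)"
proof -
  let ?L = "\<lambda>g x. if f x > 0 then g x else if f x = 0 then max 0 (g x) else (0::real)"
  let ?g' = "\<lambda>x. - g x"
  have [measurable]: "g \<in> borel_measurable lebesgue" "f \<in> borel_measurable lebesgue"
    using f g by auto
  have g': "integrable lebesgue ?g'" using g by simp
  have neg: "frechet_derivative \<psi> (at x) (- e) = - frechet_derivative \<psi> (at x) e"
    if "\<psi> \<in> test_functions W" for \<psi> W x
    using linear_neg[OF has_derivative_linear[OF test_functionD(2)[OF that]]] .
  have 1: "(LINT x|lebesgue. max 0 (f x) * frechet_derivative \<psi> (at x) e) = - (LINT x|lebesgue. ?L g x * \<psi> x)"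
    if "\<psi> \<in> test_functions V" for \<psi>
    by (rule weak_derivative_max_0_one_sided[OF f g weak V d _ that]) (use VU in auto)
  have 2: "(LINT x|lebesgue. max 0 (f x) * frechet_derivative \<psi> (at x) (- e)) = - (LINT x|lebesgue. ?L ?g' x * \<psi> x)"
    if "\<psi> \<in> test_functions V" for \<psi>
  proof (rule weak_derivative_max_0_one_sided[OF f g' _ V d _ that])
    show "x + t *\<^sub>R - e \<in> U" if "x \<in> V" "0 \<le> t" "t \<le> d" for x t
      using VU[OF that(1), of "- t"] that by simp
    show "(LINT x|lebesgue. f x * frechet_derivative \<psi> (at x) (- e)) = - (LINT x|lebesgue. - g x * \<psi> x)"
      if "\<psi> \<in> test_functions U" for \<psi>
      using weak[OF that] by (simp add: neg[OF that])
  qed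
  have Li: "integrable lebesgue (?L k)" if k: "integrable lebesgue k" for k
  proof (rule Bochner_Integration.integrable_bound[OF k])
    show "?L k \<in> borel_measurable lebesgue" using k by measurable
  qed auto
  \<comment> \<open>The two terms cancel on \<open>{f > 0}\<close>, vanish on \<open>{f < 0}\<close>
    and add up to |g| on \<open>{f = 0}\<close>. All pairings of H are 0 because the derivatives of
    a test function along e and -e cancel.\<close>
  define H where "H x = ?L g x + ?L ?g' x" for x
  have H: "integrable lebesgue H" unfolding H_def[abs_def] using Li[OF g] Li[OF g'] by simp
  have "(LINT x|lebesgue. \<bar>H x\<bar> * indicator V x) \<le> 2 * 0"
  proof (rule test_bound[OF H V])
    fix \<psi> assume \<psi>: "\<psi> \<in> test_functions V"
    have "(LINT x|lebesgue. H x * \<psi> x) = (LINT x|lebesgue. ?L g x * \<psi> x) + (LINT x|lebesgue. ?L ?g' x * \<psi> x)"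
      using integrable_mult_test[OF Li[OF g] \<psi>] integrable_mult_test[OF Li[OF g'] \<psi>]
      by (simp only: H_def distrib_right Bochner_Integration.integral_add)
    also have "\<dots> = 0" using 1[OF \<psi>] 2[OF \<psi>] by (simp add: neg[OF \<psi>])
    finally show "\<bar>LINT x|lebesgue. H x * \<psi> x\<bar> \<le> 0" by simp
  qed
  moreover have iH: "integrable lebesgue (\<lambda>x. \<bar>H x\<bar> * indicator V x)"
    using V by (intro integrable_real_mult_indicator integrable_abs H) auto
  ultimately have "(LINT x|lebesgue. \<bar>H x\<bar> * indicator V x) = 0"
    by (intro antisym Bochner_Integration.integral_nonneg) auto
  then have "AE x in lebesgue. \<bar>H x\<bar> * indicator V x = 0"
    using integral_nonneg_eq_0_iff_AE[OF iH] by simp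
  then have AE: "AE x in lebesgue. ?L g x * \<phi> x = (if f x > 0 then g x else 0) * \<phi> x"
  proof eventually_elim
    case (elim x)
    then show ?case
      using test_function_off_set(1)[OF \<phi>, of x] by (cases "x \<in> V") (auto simp: H_def split: if_splits)
  qed
  have "(LINT x|lebesgue. ?L g x * \<phi> x) = (LINT x|lebesgue. (if f x > 0 then g x else 0) * \<phi> x)"
    by (rule integral_cong_AE[OF _ _ AE]) (use test_function_measurable[OF \<phi>] in measurable)
  with 1[OF \<phi>] show ?thesis by simp
qed

subsection \<open>Weak gradients\<close>

lemma locally_integrable_indicator:
  assumes "locally_integrable \<Omega> f" "compact K" "K \<subseteq> \<Omega>"
  shows "integrable lebesgue (\<lambda>x. indicator K x *\<^sub>R f x)"
  using assms by (auto simp: locally_integrable_def set_integrable_def)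

lemma locally_integrable_add:
  assumes "locally_integrable \<Omega> f" "locally_integrable \<Omega> g"
  shows "locally_integrable \<Omega> (\<lambda>x. f x + g x)"
  using assms by (auto simp: locally_integrable_def intro!: set_integral_add)

lemma locally_integrable_diff:
  assumes "locally_integrable \<Omega> f" "locally_integrable \<Omega> g"
  shows "locally_integrable \<Omega> (\<lambda>x. f x - g x)"
  using assms by (auto simp: locally_integrable_def intro!: set_integral_diff)

lemma locally_integrable_inner:
  assumes "locally_integrable \<Omega> f"
  shows "locally_integrable \<Omega> (\<lambda>x. f x \<bullet> i)"
  unfolding locally_integrable_def set_integrable_def
proof (intro allI impI)
  fix K assume "compact K \<and> K \<subseteq> \<Omega>"
  then have "integrable lebesgue (\<lambda>x. indicator K x *\<^sub>R f x)"
    using locally_integrable_indicator[OF assms] by blast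
  then have "integrable lebesgue (\<lambda>x. (indicator K x *\<^sub>R f x) \<bullet> i)" by (rule integrable_inner_left)
  then show "integrable lebesgue (\<lambda>x. indicat_real K x *\<^sub>R (f x \<bullet> i))" by simp
qed

lemma locally_integrable_mono:
  "locally_integrable \<Omega> f \<Longrightarrow> \<Omega>' \<subseteq> \<Omega> \<Longrightarrow> locally_integrable \<Omega>' f"
  by (auto simp: locally_integrable_def)

text \<open>Truncation to K does not change the pairing with \<phi>. For compact K it makes a
  locally integrable f integrable on the whole space, which is how the results for integrable
  functions are carried over.\<close>

lemma set_integral_test:
  fixes f :: "'a::euclidean_space \<Rightarrow> real"
  assumes "\<phi> \<in> test_functions U" "U \<subseteq> K" "K \<subseteq> \<Omega>"
  shows "(LINT x:\<Omega>|lebesgue. f x * \<phi> x) = (LINT x|lebesgue. (indicator K x *\<^sub>R f x) * \<phi> x)"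
  unfolding set_lebesgue_integral_def
proof (intro Bochner_Integration.integral_cong refl)
  fix x
  show "indicator \<Omega> x *\<^sub>R (f x * \<phi> x) = (indicator K x *\<^sub>R f x) * \<phi> x"
    using test_function_off_set(1)[OF assms(1), of x] assms(2,3)
    by (cases "x \<in> U") (auto simp: indicator_def)
qed

lemma set_integrable_test:
  fixes f :: "'a::euclidean_space \<Rightarrow> real"
  assumes "locally_integrable \<Omega> f" "\<phi> \<in> test_functions \<Omega>"
  shows "set_integrable lebesgue \<Omega> (\<lambda>x. f x * \<phi> x)"
proof -
  let ?K = "closure {x. \<phi> x \<noteq> 0}"
  have K: "compact ?K" "?K \<subseteq> \<Omega>" using test_functionD(4,5)[OF assms(2)] by auto
  have "(\<lambda>x. indicat_real \<Omega> x *\<^sub>R (f x * \<phi> x)) = (\<lambda>x. (indicator ?K x *\<^sub>R f x) * \<phi> x)"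
  proof
    fix x
    show "indicat_real \<Omega> x *\<^sub>R (f x * \<phi> x) = (indicator ?K x *\<^sub>R f x) * \<phi> x"
      using test_function_off_support(1)[of x \<phi>] K(2)
      by (cases "x \<in> ?K") (auto simp: indicator_def)
  qed
  then show ?thesis unfolding set_integrable_def
    using integrable_mult_test[OF locally_integrable_indicator[OF assms(1) K] assms(2)] by simp
qed

lemma is_weak_gradientD:
  assumes "is_weak_gradient \<Omega> u g"
  shows "locally_integrable \<Omega> u" "locally_integrable \<Omega> g"
    "\<phi> \<in> test_functions \<Omega> \<Longrightarrow> i \<in> Basis \<Longrightarrow>
      (LINT x:\<Omega>|lebesgue. u x * frechet_derivative \<phi> (at x) i) = - (LINT x:\<Omega>|lebesgue. (g x \<bullet> i) * \<phi> x)"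
  using assms by (auto simp: is_weak_gradient_def)

lemma set_integrable_weak_gradient:
  assumes "is_weak_gradient \<Omega> u g" "\<phi> \<in> test_functions \<Omega>"
  shows "set_integrable lebesgue \<Omega> (\<lambda>x. u x * frechet_derivative \<phi> (at x) i)"
    "set_integrable lebesgue \<Omega> (\<lambda>x. (g x \<bullet> i) * \<phi> x)"
  using set_integrable_test[OF is_weak_gradientD(1)[OF assms(1)] test_function_directional_deriv[OF assms(2)]]
    set_integrable_test[OF locally_integrable_inner[OF is_weak_gradientD(2)[OF assms(1)]] assms(2)] by auto

lemma is_weak_gradient_add:
  assumes "is_weak_gradient \<Omega> u g" "is_weak_gradient \<Omega> v h"
  shows "is_weak_gradient \<Omega> (\<lambda>x. u x + v x) (\<lambda>x. g x + h x)"
  unfolding is_weak_gradient_def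
proof (intro conjI ballI locally_integrable_add is_weak_gradientD(1,2)[OF assms(1)] is_weak_gradientD(1,2)[OF assms(2)])
  fix \<phi> :: "'a \<Rightarrow> real" and i :: 'a assume \<phi>: "\<phi> \<in> test_functions \<Omega>" and i: "i \<in> Basis"
  note int = set_integrable_weak_gradient[OF assms(1) \<phi>] set_integrable_weak_gradient[OF assms(2) \<phi>]
  show "(LINT x:\<Omega>|lebesgue. (u x + v x) * frechet_derivative \<phi> (at x) i) =
      - (LINT x:\<Omega>|lebesgue. ((g x + h x) \<bullet> i) * \<phi> x)"
    using int is_weak_gradientD(3)[OF assms(1) \<phi> i] is_weak_gradientD(3)[OF assms(2) \<phi> i]
    by (simp add: distrib_right inner_add_left set_integral_add)
qed

lemma is_weak_gradient_diff:
  assumes "is_weak_gradient \<Omega> u g" "is_weak_gradient \<Omega> v h"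
  shows "is_weak_gradient \<Omega> (\<lambda>x. u x - v x) (\<lambda>x. g x - h x)"
  unfolding is_weak_gradient_def
proof (intro conjI ballI locally_integrable_diff is_weak_gradientD(1,2)[OF assms(1)] is_weak_gradientD(1,2)[OF assms(2)])
  fix \<phi> :: "'a \<Rightarrow> real" and i :: 'a assume \<phi>: "\<phi> \<in> test_functions \<Omega>" and i: "i \<in> Basis"
  note int = set_integrable_weak_gradient[OF assms(1) \<phi>] set_integrable_weak_gradient[OF assms(2) \<phi>]
  show "(LINT x:\<Omega>|lebesgue. (u x - v x) * frechet_derivative \<phi> (at x) i) =
      - (LINT x:\<Omega>|lebesgue. ((g x - h x) \<bullet> i) * \<phi> x)"
    using int is_weak_gradientD(3)[OF assms(1) \<phi> i] is_weak_gradientD(3)[OF assms(2) \<phi> i]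
    by (simp add: left_diff_distrib inner_diff_left set_integral_diff)
qed

lemma is_weak_gradient_subset:
  assumes "is_weak_gradient \<Omega> u g" "\<Omega>' \<subseteq> \<Omega>"
  shows "is_weak_gradient \<Omega>' u g"
  unfolding is_weak_gradient_def
proof (intro conjI ballI locally_integrable_mono[OF _ assms(2)] is_weak_gradientD(1,2)[OF assms(1)])
  fix \<phi> :: "'a \<Rightarrow> real" and i :: 'a assume \<phi>: "\<phi> \<in> test_functions \<Omega>'" and i: "i \<in> Basis"
  have "(LINT x:\<Omega>|lebesgue. f x * \<psi> x) = (LINT x:\<Omega>'|lebesgue. f x * \<psi> x)"
    if "\<psi> \<in> test_functions \<Omega>'" for \<psi> f :: "'a \<Rightarrow> real"
    using set_integral_test[OF that order_refl assms(2)] set_integral_test[OF that order_refl order_refl] by metis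
  from this[OF \<phi>] this[OF test_function_directional_deriv[OF \<phi>]]
  show "(LINT x:\<Omega>'|lebesgue. u x * frechet_derivative \<phi> (at x) i) = - (LINT x:\<Omega>'|lebesgue. (g x \<bullet> i) * \<phi> x)"
    using is_weak_gradientD(3)[OF assms(1) test_functions_mono[OF \<phi> assms(2)] i] by (simp only:)
qed

text \<open>On a ball whose closed ball lies in \<Omega> the truncated f is integrable and
  \<open>test_bound\<close> applies with c = 0. By Lindelof countably many such balls cover
  \<Omega>, so the exceptional sets add up to a null set.\<close>

lemma fundamental_lemma:
  fixes f :: "'a::euclidean_space \<Rightarrow> real"
  assumes \<Omega>: "open \<Omega>" and f: "locally_integrable \<Omega> f"
    and 0: "\<And>\<phi>. \<phi> \<in> test_functions \<Omega> \<Longrightarrow> (LINT x:\<Omega>|lebesgue. f x * \<phi> x) = 0"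
  shows "AE x in lebesgue. x \<in> \<Omega> \<longrightarrow> f x = 0"
proof -
  define F where "F = {ball x r |x r. cball x r \<subseteq> \<Omega>}"
  have ball: "AE x in lebesgue. x \<in> V \<longrightarrow> f x = 0" if V: "V \<in> F" for V
  proof -
    obtain y r where yr: "V = ball y r" "cball y r \<subseteq> \<Omega>" using V by (auto simp: F_def)
    let ?f = "\<lambda>x. indicator (cball y r) x *\<^sub>R f x"
    have i: "integrable lebesgue ?f"
      by (rule locally_integrable_indicator[OF f _ yr(2)]) simp
    have "(LINT x|lebesgue. \<bar>?f x\<bar> * indicator V x) \<le> 2 * 0"
    proof (rule test_bound[OF i])
      show "open V" using yr by simp
      fix \<psi> :: "'a \<Rightarrow> real" assume \<psi>: "\<psi> \<in> test_functions V"
      have "\<psi> \<in> test_functions \<Omega>"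
        using test_functions_mono[OF \<psi>, of \<Omega>] yr ball_subset_cball by blast
      from 0[OF this] set_integral_test[OF \<psi> _ yr(2), of f]
      show "\<bar>LINT x|lebesgue. ?f x * \<psi> x\<bar> \<le> 0" by (simp add: yr(1))
    qed
    moreover have iV: "integrable lebesgue (\<lambda>x. \<bar>?f x\<bar> * indicator V x)"
      using yr(1) by (intro integrable_real_mult_indicator integrable_abs i) auto
    ultimately have "(LINT x|lebesgue. \<bar>?f x\<bar> * indicator V x) = 0"
      by (intro antisym Bochner_Integration.integral_nonneg) auto
    then have "AE x in lebesgue. \<bar>?f x\<bar> * indicator V x = 0"
      using integral_nonneg_eq_0_iff_AE[OF iV] by simp
    then show ?thesis
    proof eventually_elim
      case (elim x)
      then show ?case using yr by (auto simp: indicator_def split: if_splits)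
    qed
  qed
  obtain F' where F': "F' \<subseteq> F" "countable F'" "\<Union>F' = \<Union>F"
    using Lindelof[of F] by (auto simp: F_def)
  have "AE x in lebesgue. \<forall>V\<in>F'. x \<in> V \<longrightarrow> f x = 0"
    using F' ball by (subst AE_ball_countable) auto
  moreover have "\<Omega> \<subseteq> \<Union>F'"
  proof
    fix x assume "x \<in> \<Omega>"
    then obtain e where "e > 0" "cball x e \<subseteq> \<Omega>" using \<Omega> open_contains_cball by blast
    then have "ball x e \<in> F" "x \<in> ball x e" by (auto simp: F_def)
    then show "x \<in> \<Union>F'" using F'(3) by blast
  qed
  ultimately show ?thesis by (auto elim!: eventually_mono)
qed

lemma weak_gradient_unique:
  assumes "open \<Omega>" "is_weak_gradient \<Omega> u g" "is_weak_gradient \<Omega> u h"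
  shows "AE x in lebesgue. x \<in> \<Omega> \<longrightarrow> g x = h x"
proof -
  have "AE x in lebesgue. x \<in> \<Omega> \<longrightarrow> (g x - h x) \<bullet> i = 0" if i: "i \<in> Basis" for i
  proof (rule fundamental_lemma[OF assms(1)])
    show "locally_integrable \<Omega> (\<lambda>x. (g x - h x) \<bullet> i)"
      by (intro locally_integrable_inner locally_integrable_diff is_weak_gradientD[OF assms(2)] is_weak_gradientD[OF assms(3)])
    fix \<phi> :: "'a \<Rightarrow> real" assume \<phi>: "\<phi> \<in> test_functions \<Omega>"
    show "(LINT x:\<Omega>|lebesgue. ((g x - h x) \<bullet> i) * \<phi> x) = 0"
      using is_weak_gradientD(3)[OF is_weak_gradient_diff[OF assms(2,3)] \<phi> i]
      by (simp add: set_lebesgue_integral_def)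
  qed
  then have "AE x in lebesgue. \<forall>i\<in>Basis. x \<in> \<Omega> \<longrightarrow> (g x - h x) \<bullet> i = 0"
    by (subst AE_ball_countable) (auto intro: countable_finite)
  then show ?thesis
    by eventually_elim (auto simp: euclidean_eq_iff[where 'a='a] inner_diff_left)
qed

section \<open>Weak gradients under changes on null sets, positive parts and extension by
  zero\<close>

lemma is_weak_gradient_cong_AE:
  assumes "is_weak_gradient \<Omega> u g"
    and v: "locally_integrable \<Omega> v" and AE: "AE x in lebesgue. x \<in> \<Omega> \<longrightarrow> u x = v x"
  shows "is_weak_gradient \<Omega> v g"
proof -
  show ?thesis unfolding is_weak_gradient_def
  proof (intro conjI ballI v is_weak_gradientD[OF assms(1)])
    fix \<phi> :: "'a \<Rightarrow> real" and i :: 'a assume \<phi>: "\<phi> \<in> test_functions \<Omega>" and i: "i \<in> Basis"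
    have "(LINT x:\<Omega>|lebesgue. v x * frechet_derivative \<phi> (at x) i) = (LINT x:\<Omega>|lebesgue. u x * frechet_derivative \<phi> (at x) i)"
      unfolding set_lebesgue_integral_def
    proof (rule integral_cong_AE)
      show "AE x in lebesgue. indicat_real \<Omega> x *\<^sub>R (v x * frechet_derivative \<phi> (at x) i) =
          indicat_real \<Omega> x *\<^sub>R (u x * frechet_derivative \<phi> (at x) i)"
        using AE by eventually_elim (auto simp: indicator_def)
    qed (use set_integrable_test[OF is_weak_gradientD(1)[OF assms(1)] test_function_directional_deriv[OF \<phi>]]
          set_integrable_test[OF v test_function_directional_deriv[OF \<phi>]] in \<open>auto simp: set_integrable_def\<close>)
    then show "(LINT x:\<Omega>|lebesgue. v x * frechet_derivative \<phi> (at x) i) = - (LINT x:\<Omega>|lebesgue. (g x \<bullet> i) * \<phi> x)"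
      using is_weak_gradientD(3)[OF assms(1) \<phi> i] by simp
  qed
qed

lemma is_weak_gradient_zero: "is_weak_gradient \<Omega> (\<lambda>x. 0) (\<lambda>x. 0)"
  by (auto simp: is_weak_gradient_def locally_integrable_def set_integrable_def set_lebesgue_integral_def)

text \<open>The identity is tested with one \<phi> and one coordinate at a time, so a and g may be
  truncated near the support of \<phi>; they become integrable and
  \<open>weak_derivative_max_0\<close> applies.\<close>

lemma is_weak_gradient_max_0:
  assumes \<Omega>: "open \<Omega>" and wg: "is_weak_gradient \<Omega> a g"
  shows "is_weak_gradient \<Omega> (\<lambda>x. max 0 (a x)) (\<lambda>x. if a x > 0 then g x else 0)"
  unfolding is_weak_gradient_def
proof (intro conjI ballI)
  note la = is_weak_gradientD(1)[OF wg] and lg = is_weak_gradientD(2)[OF wg]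
  show "locally_integrable \<Omega> (\<lambda>x. max 0 (a x))"
    unfolding locally_integrable_def set_integrable_def
  proof (intro allI impI)
    fix K assume "compact K \<and> K \<subseteq> \<Omega>"
    then have "integrable lebesgue (\<lambda>x. max 0 (indicator K x *\<^sub>R a x))"
      using locally_integrable_indicator[OF la] by auto
    moreover have "(\<lambda>x. indicat_real K x *\<^sub>R max 0 (a x)) = (\<lambda>x. max 0 (indicator K x *\<^sub>R a x))"
      by (auto simp: indicator_def)
    ultimately show "integrable lebesgue (\<lambda>x. indicat_real K x *\<^sub>R max 0 (a x))" by simp
  qed
  show "locally_integrable \<Omega> (\<lambda>x. if a x > 0 then g x else 0)"
    unfolding locally_integrable_def set_integrable_def
  proof (intro allI impI)
    fix K assume K: "compact K \<and> K \<subseteq> \<Omega>"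
    then have 1: "integrable lebesgue (\<lambda>x. indicator K x *\<^sub>R a x)" and 2: "integrable lebesgue (\<lambda>x. indicator K x *\<^sub>R g x)"
      using locally_integrable_indicator[OF la] locally_integrable_indicator[OF lg] by auto
    have "{x \<in> space lebesgue. indicator K x *\<^sub>R a x > 0} \<in> sets lebesgue"
      using borel_measurable_integrable[OF 1] by measurable
    from integrable_mult_indicator[OF this 2]
    show "integrable lebesgue (\<lambda>x. indicat_real K x *\<^sub>R (if a x > 0 then g x else 0))"
      by (rule Bochner_Integration.integrable_cong[THEN iffD1, rotated -1])
        (auto simp: indicator_def)
  qed
  fix \<phi> :: "'a \<Rightarrow> real" and i :: 'a assume \<phi>: "\<phi> \<in> test_functions \<Omega>" and i: "i \<in> Basis"
  let ?S = "closure {x. \<phi> x \<noteq> 0}"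
  obtain d where d: "d > 0" "(\<Union>x\<in>?S. cball x d) \<subseteq> \<Omega>"
    using compact_subset_open_imp_cball_epsilon_subset[OF test_functionD(4)[OF \<phi>] \<Omega> test_functionD(5)[OF \<phi>]] by blast
  \<comment> \<open>Three neighbourhoods of the support: the compact \<open>K\<close> carries the
    truncation, the weak identity survives the truncation for tests in \<open>U\<close>, and
    \<open>V\<close> leaves room for shifts by d/3, since d/2 + d/3 < d.\<close>
  define K where "K = (\<Union>x\<in>?S. cball x d)"
  define U where "U = (\<Union>x\<in>?S. ball x d)"
  define V where "V = (\<Union>x\<in>?S. ball x (d / 2))"
  have K: "compact K" "K \<subseteq> \<Omega>"
  proof -
    \<comment> \<open>K is the sum of the support and a closed ball about 0, hence compact.\<close>
    have "K = (\<Union>x\<in>?S. \<Union>y\<in>cball 0 d. {x + y})"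
    proof (rule set_eqI)
      fix z :: 'a
      have "z \<in> cball x d \<longleftrightarrow> (\<exists>y\<in>cball 0 d. z = x + y)" for x
        by (auto simp: dist_norm norm_minus_commute intro!: bexI[of _ "z - x"])
      then show "z \<in> K \<longleftrightarrow> z \<in> (\<Union>x\<in>?S. \<Union>y\<in>cball 0 d. {x + y})"
        unfolding K_def by blast
    qed
    then show "compact K" using compact_sums'[OF test_functionD(4)[OF \<phi>] compact_cball] by (simp only:)
    show "K \<subseteq> \<Omega>" using d by (simp add: K_def)
  qed
  have UK: "U \<subseteq> K" and VU: "V \<subseteq> U" and Vo: "open V"
    using d by (auto simp: U_def V_def K_def intro: less_imp_le)
  have \<phi>V: "\<phi> \<in> test_functions V"
  proof (rule test_functionI[OF test_functionD(1,4)[OF \<phi>]])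
    show "?S \<subseteq> V" using d(1) by (force simp: V_def)
  qed (rule test_function_off_support(1))
  let ?f = "\<lambda>x. indicator K x *\<^sub>R a x" and ?g = "\<lambda>x. indicator K x *\<^sub>R (g x \<bullet> i)"
  have "(LINT x|lebesgue. max 0 (?f x) * frechet_derivative \<phi> (at x) i) =
      - (LINT x|lebesgue. (if ?f x > 0 then ?g x else 0) * \<phi> x)"
  proof (rule weak_derivative_max_0[OF _ _ _ Vo _ _ \<phi>V])
    show "integrable lebesgue ?f" by (rule locally_integrable_indicator[OF la K])
    show "integrable lebesgue ?g" by (rule locally_integrable_indicator[OF locally_integrable_inner[OF lg] K])
    show "d / 3 > 0" using d by simp
    show "x + t *\<^sub>R i \<in> U" if x: "x \<in> V" and t: "\<bar>t\<bar> \<le> d / 3" for x t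
    proof -
      obtain y where y: "y \<in> ?S" "dist y x < d / 2" using x by (auto simp: V_def)
      have "dist x (x + t *\<^sub>R i) \<le> d / 3" using t i by (simp add: dist_norm)
      then have "dist y (x + t *\<^sub>R i) < d" using y(2) dist_triangle[of y "x + t *\<^sub>R i" x] d(1) by linarith
      then show ?thesis using y(1) by (auto simp: U_def)
    qed
    fix \<psi> :: "'a \<Rightarrow> real" assume \<psi>: "\<psi> \<in> test_functions U"
    have "\<psi> \<in> test_functions \<Omega>" using test_functions_mono[OF \<psi>] UK K by blast
    from is_weak_gradientD(3)[OF wg this i]
    show "(LINT x|lebesgue. ?f x * frechet_derivative \<psi> (at x) i) = - (LINT x|lebesgue. ?g x * \<psi> x)"
      unfolding set_integral_test[OF \<psi> UK K(2)] set_integral_test[OF test_function_directional_deriv[OF \<psi>] UK K(2)] .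
  qed
  moreover have "(LINT x|lebesgue. max 0 (?f x) * frechet_derivative \<phi> (at x) i) =
      (LINT x:\<Omega>|lebesgue. max 0 (a x) * frechet_derivative \<phi> (at x) i)"
    unfolding set_integral_test[OF test_function_directional_deriv[OF \<phi>V] order_trans[OF VU UK] K(2)]
    by (intro Bochner_Integration.integral_cong) (auto simp: indicator_def)
  moreover have "(LINT x|lebesgue. (if ?f x > 0 then ?g x else 0) * \<phi> x) =
      (LINT x:\<Omega>|lebesgue. ((if a x > 0 then g x else 0) \<bullet> i) * \<phi> x)"
    unfolding set_integral_test[OF \<phi>V order_trans[OF VU UK] K(2)]
    by (intro Bochner_Integration.integral_cong) (auto simp: indicator_def)
  ultimately show "(LINT x:\<Omega>|lebesgue. max 0 (a x) * frechet_derivative \<phi> (at x) i) =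
      - (LINT x:\<Omega>|lebesgue. ((if a x > 0 then g x else 0) \<bullet> i) * \<phi> x)"
    by simp
qed

text \<open>Since a = max 0 a - max 0 (-a), the chain rule produces another weak gradient of a,
  which is 0 wherever a = 0; uniqueness transfers this to g.\<close>

lemma weak_gradient_zero_level:
  assumes \<Omega>: "open \<Omega>" and wg: "is_weak_gradient \<Omega> a g"
  shows "AE x in lebesgue. x \<in> \<Omega> \<longrightarrow> a x = 0 \<longrightarrow> g x = 0"
proof -
  have "is_weak_gradient \<Omega> (\<lambda>x. 0 - a x) (\<lambda>x. 0 - g x)"
    by (rule is_weak_gradient_diff[OF is_weak_gradient_zero wg])
  from is_weak_gradient_diff[OF is_weak_gradient_max_0[OF \<Omega> wg] is_weak_gradient_max_0[OF \<Omega> this]]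
  have "is_weak_gradient \<Omega> a (\<lambda>x. (if a x > 0 then g x else 0) - (if 0 - a x > 0 then 0 - g x else 0))"
    by (rule back_subst[where P="\<lambda>f. is_weak_gradient \<Omega> f _"]) auto
  from weak_gradient_unique[OF \<Omega> wg this] show ?thesis
    by eventually_elim auto
qed

text \<open>A cutoff \<zeta> equal to 1 near S turns a test function on the whole space into one on
  \<Omega>. The derivative of \<zeta> vanishes on S, so the pairings on S are unchanged.\<close>

lemma is_weak_gradient_extend:
  assumes \<Omega>: "open \<Omega>" and wg: "is_weak_gradient \<Omega> f g" and S: "compact S" "S \<subseteq> \<Omega>"
    and 0: "AE x in lebesgue. x \<in> \<Omega> \<longrightarrow> x \<notin> S \<longrightarrow> f x = 0"
  shows "is_weak_gradient UNIV (\<lambda>x. if x \<in> S then f x else 0) (\<lambda>x. if x \<in> S then g x else 0)"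
  unfolding is_weak_gradient_def
proof (intro conjI ballI)
  have loc: "locally_integrable UNIV (\<lambda>x. if x \<in> S then k x else 0)" if k: "locally_integrable \<Omega> k"
    for k :: "'a \<Rightarrow> 'b::euclidean_space"
    unfolding locally_integrable_def set_integrable_def
  proof (intro allI impI)
    fix K :: "'a set" assume "compact K \<and> K \<subseteq> UNIV"
    then have "integrable lebesgue (\<lambda>x. indicator (K \<inter> S) x *\<^sub>R k x)"
      using S by (intro locally_integrable_indicator[OF k] compact_Int) auto
    then show "integrable lebesgue (\<lambda>x. indicat_real K x *\<^sub>R (if x \<in> S then k x else 0))"
      by (rule Bochner_Integration.integrable_cong[THEN iffD1, rotated -1])
        (auto simp: indicator_def)
  qed
  show "locally_integrable UNIV (\<lambda>x. if x \<in> S then f x else 0)"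
    "locally_integrable UNIV (\<lambda>x. if x \<in> S then g x else 0)"
    by (intro loc is_weak_gradientD[OF wg])+
  \<comment> \<open>On the open set \<open>\<Omega> - S\<close> the function is 0 almost everywhere,
    so by uniqueness g is 0 there as well and may also be cut off at S.\<close>
  have o: "open (\<Omega> - S)" using \<Omega> S compact_imp_closed by blast
  have "is_weak_gradient (\<Omega> - S) (\<lambda>x. 0) g"
    by (rule is_weak_gradient_cong_AE[OF is_weak_gradient_subset[OF wg Diff_subset]])
      (use 0 is_weak_gradientD(1)[OF is_weak_gradient_zero] in \<open>auto elim!: eventually_mono\<close>)
  from weak_gradient_unique[OF o this is_weak_gradient_zero]
  have g0: "AE x in lebesgue. x \<in> \<Omega> \<longrightarrow> x \<notin> S \<longrightarrow> g x = 0" by (auto elim!: eventually_mono)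
  fix \<phi> :: "'a \<Rightarrow> real" and i :: 'a assume \<phi>: "\<phi> \<in> test_functions UNIV" and i: "i \<in> Basis"
  obtain \<zeta> W where \<zeta>: "\<zeta> \<in> test_functions \<Omega>" and W: "open W" "S \<subseteq> W" "\<And>x. x \<in> W \<Longrightarrow> \<zeta> x = 1"
    using smooth_Urysohn[OF S(1) \<Omega> S(2)] by metis
  have \<zeta>\<phi>: "(\<lambda>x. \<zeta> x * \<phi> x) \<in> test_functions \<Omega>"
    using test_function_mult(1)[OF \<zeta> \<phi>] by simp
  have D\<zeta>: "frechet_derivative \<zeta> (at x) i = 0" if "x \<in> S" for x
  proof -
    have "(\<zeta> has_derivative (\<lambda>v. 0)) (at x)"
      by (rule has_derivative_transform_within_open[OF has_derivative_const W(1)])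
        (use W that in auto)
    then show ?thesis by (metis frechet_derivative_at)
  qed
  have eq: "(LINT x:\<Omega>|lebesgue. k x * \<psi> x) = (LINT x:UNIV|lebesgue. (if x \<in> S then k x else 0) * \<eta> x)"
    if k: "locally_integrable \<Omega> k" "AE x in lebesgue. x \<in> \<Omega> \<longrightarrow> x \<notin> S \<longrightarrow> k x = 0"
      and \<psi>: "\<psi> \<in> test_functions \<Omega>" "\<eta> \<in> test_functions UNIV" "\<And>x. x \<in> S \<Longrightarrow> \<psi> x = \<eta> x"
    for k \<psi> \<eta> :: "'a \<Rightarrow> real"
    unfolding set_lebesgue_integral_def
  proof (rule integral_cong_AE)
    show "AE x in lebesgue. indicat_real \<Omega> x *\<^sub>R (k x * \<psi> x) =
        indicat_real UNIV x *\<^sub>R ((if x \<in> S then k x else 0) * \<eta> x)"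
      using k(2) by eventually_elim (use S \<psi>(3) in \<open>auto simp: indicator_def\<close>)
  qed (use set_integrable_test[OF k(1) \<psi>(1)] set_integrable_test[OF loc[OF k(1)] \<psi>(2)]
        in \<open>auto simp: set_integrable_def\<close>)
  have "(LINT x:UNIV|lebesgue. (if x \<in> S then f x else 0) * frechet_derivative \<phi> (at x) i) =
      (LINT x:\<Omega>|lebesgue. f x * frechet_derivative (\<lambda>x. \<zeta> x * \<phi> x) (at x) i)"
  proof (rule eq[symmetric])
    show "frechet_derivative (\<lambda>x. \<zeta> x * \<phi> x) (at x) i = frechet_derivative \<phi> (at x) i" if "x \<in> S" for x
      using D\<zeta>[OF that] W that by (auto simp: test_function_mult(2)[OF \<zeta> \<phi>])
  qed (use 0 is_weak_gradientD(1)[OF wg] test_function_directional_deriv \<zeta>\<phi> \<phi> in blast)+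
  also have "\<dots> = - (LINT x:\<Omega>|lebesgue. (g x \<bullet> i) * (\<zeta> x * \<phi> x))"
    by (rule is_weak_gradientD(3)[OF wg \<zeta>\<phi> i])
  also have "(LINT x:\<Omega>|lebesgue. (g x \<bullet> i) * (\<zeta> x * \<phi> x)) =
      (LINT x:UNIV|lebesgue. (if x \<in> S then g x \<bullet> i else 0) * \<phi> x)"
  proof (rule eq)
    show "AE x in lebesgue. x \<in> \<Omega> \<longrightarrow> x \<notin> S \<longrightarrow> g x \<bullet> i = 0"
      using g0 by (auto elim!: eventually_mono)
  qed (use locally_integrable_inner[OF is_weak_gradientD(2)[OF wg]] \<zeta>\<phi> \<phi> W in auto)
  also have "(\<lambda>x. if x \<in> S then g x \<bullet> i else 0) = (\<lambda>x. (if x \<in> S then g x else 0) \<bullet> i)" by auto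
  finally show "(LINT x:UNIV|lebesgue. (if x \<in> S then f x else 0) * frechet_derivative \<phi> (at x) i) =
      - (LINT x:UNIV|lebesgue. ((if x \<in> S then g x else 0) \<bullet> i) * \<phi> x)"
    by (simp add: fun_eq_iff)
qed

subsection \<open>The modular\<close>

text \<open>\<open>Lp_norm\<close> is the Luxemburg gauge of this modular. With the measure as a
  parameter, limit theorems apply without carrying the indicator of \<Omega>.\<close>

definition modular :: "'a measure \<Rightarrow> ('a \<Rightarrow> real) \<Rightarrow> ('a \<Rightarrow> 'b::euclidean_space) \<Rightarrow> ennreal" where
  "modular M q f = (\<integral>\<^sup>+x. ennreal (norm (f x) powr q x) \<partial>M)"

lemma modular_cong_AE: "AE x in M. f x = g x \<Longrightarrow> modular M q f = modular M q g"
  unfolding modular_def by (intro nn_integral_cong_AE) auto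

text \<open>P will come from an essential supremum, hence the bounds hold almost everywhere
  only.\<close>

locale bounded_exponent =
  fixes M :: "'a measure" and q :: "'a \<Rightarrow> real" and P :: real
  assumes exponent_measurable[measurable]: "q \<in> borel_measurable M"
    and exponent_bounds: "AE x in M. 1 \<le> q x \<and> q x \<le> P"
begin

lemma modular_mono_AE:
  assumes "AE x in M. norm (f x) \<le> norm (g x)"
  shows "modular M q f \<le> modular M q g"
  unfolding modular_def
proof (intro nn_integral_mono_AE)
  show "AE x in M. ennreal (norm (f x) powr q x) \<le> ennreal (norm (g x) powr q x)"
    using assms exponent_bounds by eventually_elim (auto intro!: ennreal_leI powr_mono2)
qed

text \<open>Writing f = t (f / t) extracts the factor t^q(x). Its largest value is attained at
  exponent 1 for t \<le> 1 and at P for t \<ge> 1, so c is left open to serve both cases.\<close>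

lemma modular_le_scaled:
  fixes f :: "'a \<Rightarrow> 'b::euclidean_space"
  assumes [measurable]: "f \<in> borel_measurable M" and t: "t > 0"
    and c: "\<And>r. 1 \<le> r \<Longrightarrow> r \<le> P \<Longrightarrow> t powr r \<le> c"
  shows "modular M q f \<le> ennreal c * modular M q (\<lambda>x. f x /\<^sub>R t)"
proof -
  have "modular M q f \<le> (\<integral>\<^sup>+x. ennreal c * ennreal (norm (f x /\<^sub>R t) powr q x) \<partial>M)"
    unfolding modular_def
  proof (intro nn_integral_mono_AE)
    show "AE x in M. ennreal (norm (f x) powr q x) \<le> ennreal c * ennreal (norm (f x /\<^sub>R t) powr q x)"
      using exponent_bounds
    proof eventually_elim
      case (elim x)
      have "norm (f x) = t * norm (f x /\<^sub>R t)" using t by simp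
      then have "norm (f x) powr q x = t powr q x * norm (f x /\<^sub>R t) powr q x"
        using t powr_mult[of t "norm (f x /\<^sub>R t)" "q x"] by (metis)
      also have "\<dots> \<le> c * norm (f x /\<^sub>R t) powr q x"
        using c[of "q x"] elim by (intro mult_right_mono) auto
      finally show ?case by (subst ennreal_mult''[symmetric]) (auto intro: ennreal_leI)
    qed
  qed
  also have "\<dots> = ennreal c * modular M q (\<lambda>x. f x /\<^sub>R t)"
    unfolding modular_def by (rule nn_integral_cmult) measurable
  finally show ?thesis .
qed

text \<open>Pointwise |f + g| \<le> 2 max(|f|, |g|), and a power of the maximum is at most the sum
  of the powers. This plays the role of the triangle inequality for the modular.\<close>

lemma modular_add:
  fixes f g :: "'a \<Rightarrow> 'b::euclidean_space"
  assumes [measurable]: "f \<in> borel_measurable M" "g \<in> borel_measurable M"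
  shows "modular M q (\<lambda>x. f x + g x) \<le> ennreal (2 powr P) * (modular M q f + modular M q g)"
proof -
  have "modular M q (\<lambda>x. f x + g x) \<le>
      (\<integral>\<^sup>+x. ennreal (2 powr P) * (ennreal (norm (f x) powr q x) + ennreal (norm (g x) powr q x)) \<partial>M)"
    unfolding modular_def
  proof (intro nn_integral_mono_AE)
    show "AE x in M. ennreal (norm (f x + g x) powr q x) \<le>
        ennreal (2 powr P) * (ennreal (norm (f x) powr q x) + ennreal (norm (g x) powr q x))"
      using exponent_bounds
    proof eventually_elim
      case (elim x)
      define m where "m = max (norm (f x)) (norm (g x))"
      have "norm (f x + g x) \<le> 2 * m"
        unfolding m_def using norm_triangle_ineq[of "f x" "g x"] by linarith
      then have "norm (f x + g x) powr q x \<le> (2 * m) powr q x"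
        using elim by (intro powr_mono2) auto
      also have "\<dots> = 2 powr q x * m powr q x"
        by (rule powr_mult)
      also have "\<dots> \<le> 2 powr P * (norm (f x) powr q x + norm (g x) powr q x)"
        using elim by (intro mult_mono powr_mono) (auto simp: m_def max_def)
      finally show ?case
        by (simp add: ennreal_leI flip: ennreal_mult' ennreal_plus)
    qed
  qed
  also have "\<dots> = ennreal (2 powr P) * (modular M q f + modular M q g)"
    unfolding modular_def by (subst nn_integral_cmult nn_integral_add; measurable)+
  finally show ?thesis .
qed

lemma modular_diff:
  fixes f g :: "'a \<Rightarrow> 'b::euclidean_space"
  assumes [measurable]: "f \<in> borel_measurable M" "g \<in> borel_measurable M"
  shows "modular M q (\<lambda>x. f x - g x) \<le> ennreal (2 powr P) * (modular M q f + modular M q g)"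
  using modular_add[of f "\<lambda>x. - g x"] by (simp add: modular_def)

end

subsection \<open>Variable exponent spaces in terms of the modular\<close>

abbreviation Lp_modular :: "('a::euclidean_space \<Rightarrow> ereal) \<Rightarrow> 'a set \<Rightarrow> ('a \<Rightarrow> 'b::euclidean_space) \<Rightarrow> ennreal" where
  "Lp_modular p \<Omega> \<equiv> modular (lebesgue_on \<Omega>) (\<lambda>x. real_of_ereal (p x))"

lemma AE_lebesgue_on_open: "open \<Omega> \<Longrightarrow> (AE x in lebesgue_on \<Omega>. Q x) \<longleftrightarrow> (AE x in lebesgue. x \<in> \<Omega> \<longrightarrow> Q x)"
  by (subst AE_restrict_space_iff) auto

text \<open>All open sets are covered at once because u lives on \<Omega> while the approximants
  live on \<open>UNIV\<close>.\<close>

locale variable_exponent =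
  fixes p :: "'a::euclidean_space \<Rightarrow> ereal" and P :: real
  assumes bounded: "\<And>\<Omega>. open \<Omega> \<Longrightarrow> bounded_exponent (lebesgue_on \<Omega>) (\<lambda>x. real_of_ereal (p x)) P"

lemma admissible_exponent_bounded:
  assumes p: "admissible_exponent p"
  obtains P where "variable_exponent p P"
proof -
  have [measurable]: "p \<in> borel_measurable lebesgue" and p1: "\<And>x. 1 \<le> p x"
    and es: "esssup lebesgue p < \<infinity>" using p by (auto simp: admissible_exponent_def)
  obtain P where P: "esssup lebesgue p \<le> ereal P"
    using es by (cases "esssup lebesgue p") auto
  have AE: "AE x in lebesgue. 1 \<le> real_of_ereal (p x) \<and> real_of_ereal (p x) \<le> P"
    using esssup_AE[of p lebesgue]
  proof eventually_elim
    case (elim x)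
    then have "p x \<le> ereal P" using P by (rule order_trans)
    then show ?case using p1[of x] by (cases "p x") auto
  qed
  have "bounded_exponent (lebesgue_on \<Omega>) (\<lambda>x. real_of_ereal (p x)) P" if \<Omega>: "open \<Omega>" for \<Omega>
  proof
    show "(\<lambda>x. real_of_ereal (p x)) \<in> borel_measurable (lebesgue_on \<Omega>)"
      by (intro measurable_restrict_space1) measurable
    show "AE x in lebesgue_on \<Omega>. 1 \<le> real_of_ereal (p x) \<and> real_of_ereal (p x) \<le> P"
      unfolding AE_lebesgue_on_open[OF \<Omega>] using AE by eventually_elim auto
  qed
  then show ?thesis using that unfolding variable_exponent_def by blast
qed

lemma Lp_norm_eq_modular:
  fixes u :: "'a::euclidean_space \<Rightarrow> 'b::euclidean_space"
  assumes "open \<Omega>"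
  shows "Lp_norm p \<Omega> u = (INF t\<in>{t. t > 0 \<and> Lp_modular p \<Omega> (\<lambda>x. u x /\<^sub>R t) \<le> 1}. ennreal t)"
proof -
  have "(\<integral>\<^sup>+x\<in>\<Omega>. ennreal ((norm (u x) / t) powr real_of_ereal (p x)) \<partial>lebesgue) = Lp_modular p \<Omega> (\<lambda>x. u x /\<^sub>R t)"
    if "t > 0" for t
    using that assms unfolding modular_def by (subst nn_integral_restrict_space) (auto simp: divide_inverse mult.commute)
  then show ?thesis unfolding Lp_norm_def by (intro arg_cong[where f="\<lambda>S. Inf (ennreal ` S)"]) auto
qed

lemma Lp_norm_cong_AE:
  fixes u v :: "'a::euclidean_space \<Rightarrow> 'b::euclidean_space"
  assumes "open \<Omega>" "AE x in lebesgue_on \<Omega>. u x = v x"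
  shows "Lp_norm p \<Omega> u = Lp_norm p \<Omega> v"
proof -
  have "Lp_modular p \<Omega> (\<lambda>x. u x /\<^sub>R t) = Lp_modular p \<Omega> (\<lambda>x. v x /\<^sub>R t)" for t
    by (rule modular_cong_AE) (use assms(2) in \<open>auto elim!: eventually_mono\<close>)
  then show ?thesis unfolding Lp_norm_eq_modular[OF assms(1)] by simp
qed

context variable_exponent
begin

text \<open>Some t < \<delta> \<le> 1 brings the modular of f / t down to 1, and t^r \<le> t for r
  \<ge> 1 gives back a factor t.\<close>

lemma modular_le_of_Lp_norm_less:
  fixes f :: "'a \<Rightarrow> 'b::euclidean_space"
  assumes \<Omega>: "open \<Omega>" and f: "f \<in> borel_measurable (lebesgue_on \<Omega>)"
    and less: "Lp_norm p \<Omega> f < ennreal \<delta>" and \<delta>: "\<delta> \<le> 1"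
  shows "Lp_modular p \<Omega> f \<le> ennreal \<delta>"
proof -
  interpret bounded_exponent "lebesgue_on \<Omega>" "\<lambda>x. real_of_ereal (p x)" P by (rule bounded[OF \<Omega>])
  obtain t where t: "t > 0" "Lp_modular p \<Omega> (\<lambda>x. f x /\<^sub>R t) \<le> 1" "ennreal t < ennreal \<delta>"
    using less unfolding Lp_norm_eq_modular[OF \<Omega>] INF_less_iff by auto
  have "t < \<delta>" using t(1,3) by (simp add: ennreal_less_iff)
  have "t powr r \<le> t" if "1 \<le> r" for r
    using powr_mono'[of 1 r t] that t(1) \<open>t < \<delta>\<close> \<delta> by simp
  then have "Lp_modular p \<Omega> f \<le> ennreal t * Lp_modular p \<Omega> (\<lambda>x. f x /\<^sub>R t)"
    by (intro modular_le_scaled f t(1)) auto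
  also have "\<dots> \<le> ennreal t * 1" by (intro mult_left_mono t) auto
  also have "\<dots> \<le> ennreal \<delta>" using t(3) by simp
  finally show ?thesis .
qed

text \<open>Dividing f by \<delta> \<le> 1 enlarges the modular at most by the factor \<delta>^(-P),
  which the threshold \<delta>^P compensates exactly.\<close>

lemma Lp_norm_le_of_modular_le:
  fixes f :: "'a \<Rightarrow> 'b::euclidean_space"
  assumes \<Omega>: "open \<Omega>" and f: "f \<in> borel_measurable (lebesgue_on \<Omega>)"
    and le: "Lp_modular p \<Omega> f \<le> ennreal (\<delta> powr P)" and \<delta>: "0 < \<delta>" "\<delta> \<le> 1"
  shows "Lp_norm p \<Omega> f \<le> ennreal \<delta>"
  unfolding Lp_norm_eq_modular[OF \<Omega>]
proof (intro INF_lower CollectI conjI \<delta>(1))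
  interpret bounded_exponent "lebesgue_on \<Omega>" "\<lambda>x. real_of_ereal (p x)" P by (rule bounded[OF \<Omega>])
  have [measurable]: "(\<lambda>x. f x /\<^sub>R \<delta>) \<in> borel_measurable (lebesgue_on \<Omega>)" using f by measurable
  have c: "inverse \<delta> powr r \<le> inverse (\<delta> powr P)" if "r \<le> P" for r
    using powr_mono[OF that, of "inverse \<delta>"] \<delta> by (simp add: inverse_powr one_le_inverse)
  have "Lp_modular p \<Omega> (\<lambda>x. f x /\<^sub>R \<delta>) \<le>
      ennreal (inverse (\<delta> powr P)) * Lp_modular p \<Omega> (\<lambda>x. (f x /\<^sub>R \<delta>) /\<^sub>R inverse \<delta>)"
    by (intro modular_le_scaled c) (use \<delta> in auto)
  also have "(\<lambda>x. (f x /\<^sub>R \<delta>) /\<^sub>R inverse \<delta>) = f" using \<delta> by auto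
  also have "ennreal (inverse (\<delta> powr P)) * Lp_modular p \<Omega> f \<le> ennreal (inverse (\<delta> powr P)) * ennreal (\<delta> powr P)"
    by (intro mult_left_mono le) auto
  also have "\<dots> = 1" using \<delta> by (simp flip: ennreal_mult')
  finally show "Lp_modular p \<Omega> (\<lambda>x. f x /\<^sub>R \<delta>) \<le> 1" .
qed

lemma Lp_space_iff_modular:
  fixes f :: "'a \<Rightarrow> 'b::euclidean_space"
  assumes \<Omega>: "open \<Omega>"
  shows "f \<in> Lp_space p \<Omega> \<longleftrightarrow> f \<in> borel_measurable (lebesgue_on \<Omega>) \<and> Lp_modular p \<Omega> f < \<infinity>"
proof -
  interpret bounded_exponent "lebesgue_on \<Omega>" "\<lambda>x. real_of_ereal (p x)" P by (rule bounded[OF \<Omega>])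
  have "Lp_norm p \<Omega> f < \<infinity> \<longleftrightarrow> Lp_modular p \<Omega> f < \<infinity>" if f[measurable]: "f \<in> borel_measurable (lebesgue_on \<Omega>)"
  proof
    assume "Lp_norm p \<Omega> f < \<infinity>"
    then obtain t where t: "t > 0" "Lp_modular p \<Omega> (\<lambda>x. f x /\<^sub>R t) \<le> 1"
      unfolding Lp_norm_eq_modular[OF \<Omega>] INF_less_iff by auto
    have "t powr r \<le> max 1 t powr P" if "1 \<le> r" "r \<le> P" for r
    proof -
      have "t powr r \<le> max 1 t powr r" using t(1) that by (intro powr_mono2) auto
      also have "\<dots> \<le> max 1 t powr P" using that by (intro powr_mono) auto
      finally show ?thesis .
    qed
    then have "Lp_modular p \<Omega> f \<le> ennreal (max 1 t powr P) * Lp_modular p \<Omega> (\<lambda>x. f x /\<^sub>R t)"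
      by (intro modular_le_scaled f t(1)) auto
    also have "\<dots> \<le> ennreal (max 1 t powr P) * 1" by (intro mult_left_mono t) auto
    also have "\<dots> < \<infinity>" by simp
    finally show "Lp_modular p \<Omega> f < \<infinity>" .
  next
    assume "Lp_modular p \<Omega> f < \<infinity>"
    then obtain C where C: "C \<ge> 0" "Lp_modular p \<Omega> f = ennreal C"
      by (cases "Lp_modular p \<Omega> f") auto
    \<comment> \<open>Division by t \<ge> 1 lowers the modular at least by the factor 1/t, because
      all exponents are at least 1; t \<ge> C then brings it down to 1.\<close>
    define t where "t = max 1 C"
    have t: "t \<ge> 1" "t \<ge> C" by (auto simp: t_def)
    have c: "inverse t powr r \<le> inverse t" if "1 \<le> r" for r
      using powr_mono'[OF that, of "inverse t"] t by (simp add: inverse_le_1_iff)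
    have "Lp_modular p \<Omega> (\<lambda>x. f x /\<^sub>R t) \<le>
        ennreal (inverse t) * Lp_modular p \<Omega> (\<lambda>x. (f x /\<^sub>R t) /\<^sub>R inverse t)"
      by (intro modular_le_scaled c) (use t in auto)
    also have "(\<lambda>x. (f x /\<^sub>R t) /\<^sub>R inverse t) = f" using t by auto
    also have "ennreal (inverse t) * Lp_modular p \<Omega> f = ennreal (inverse t * C)"
      using C t by (simp add: ennreal_mult')
    also have "\<dots> \<le> 1" using t C(1) by (simp add: field_simps)
    finally have "Lp_norm p \<Omega> f \<le> ennreal t"
      unfolding Lp_norm_eq_modular[OF \<Omega>] using t by (intro INF_lower) auto
    then show "Lp_norm p \<Omega> f < \<infinity>" by (auto intro: le_less_trans)
  qed
  then show ?thesis by (auto simp: Lp_space_def)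
qed

section \<open>Closure properties of variable exponent Lebesgue spaces\<close>

lemma Lp_space_add:
  fixes f g :: "'a \<Rightarrow> 'b::euclidean_space"
  assumes "open \<Omega>" "f \<in> Lp_space p \<Omega>" "g \<in> Lp_space p \<Omega>"
  shows "(\<lambda>x. f x + g x) \<in> Lp_space p \<Omega>"
proof -
  interpret bounded_exponent "lebesgue_on \<Omega>" "\<lambda>x. real_of_ereal (p x)" P by (rule bounded[OF assms(1)])
  note fg = assms(2,3)[unfolded Lp_space_iff_modular[OF assms(1)]]
  then have "ennreal (2 powr P) * (Lp_modular p \<Omega> f + Lp_modular p \<Omega> g) < \<infinity>"
    by (simp add: ennreal_mult_less_top)
  with modular_add[of f g] fg show ?thesis
    unfolding Lp_space_iff_modular[OF assms(1)] by (auto intro: le_less_trans)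
qed

lemma Lp_space_bound:
  fixes f :: "'a \<Rightarrow> 'b::euclidean_space" and g :: "'a \<Rightarrow> 'c::euclidean_space"
  assumes \<Omega>: "open \<Omega>" and f: "f \<in> Lp_space p \<Omega>"
    and g: "g \<in> borel_measurable (lebesgue_on \<Omega>)" "\<And>x. norm (g x) \<le> norm (f x)"
  shows "g \<in> Lp_space p \<Omega>"
proof -
  interpret bounded_exponent "lebesgue_on \<Omega>" "\<lambda>x. real_of_ereal (p x)" P by (rule bounded[OF \<Omega>])
  have "Lp_modular p \<Omega> g \<le> Lp_modular p \<Omega> f"
    unfolding modular_def
  proof (intro nn_integral_mono_AE)
    show "AE x in lebesgue_on \<Omega>. ennreal (norm (g x) powr real_of_ereal (p x)) \<le> ennreal (norm (f x) powr real_of_ereal (p x))"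
      using exponent_bounds by eventually_elim (auto intro!: ennreal_leI powr_mono2 g)
  qed
  with f g(1) show ?thesis
    unfolding Lp_space_iff_modular[OF \<Omega>] by (auto intro: le_less_trans)
qed

lemma Lp_space_diff:
  fixes f g :: "'a \<Rightarrow> 'b::euclidean_space"
  assumes "open \<Omega>" "f \<in> Lp_space p \<Omega>" "g \<in> Lp_space p \<Omega>"
  shows "(\<lambda>x. f x - g x) \<in> Lp_space p \<Omega>"
proof -
  have "(\<lambda>x. - g x) \<in> Lp_space p \<Omega>"
    using assms(3) by (intro Lp_space_bound[OF assms(1,3)]) (auto simp: Lp_space_def)
  from Lp_space_add[OF assms(1,2) this] show ?thesis by simp
qed

lemma Lp_space_subset:
  fixes f :: "'a \<Rightarrow> 'b::euclidean_space"
  assumes "f \<in> Lp_space p UNIV" "open \<Omega>"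
  shows "f \<in> Lp_space p \<Omega>"
proof -
  have f: "f \<in> borel_measurable lebesgue" "Lp_modular p UNIV f < \<infinity>"
    using assms(1) unfolding Lp_space_iff_modular[OF open_UNIV] by auto
  have "Lp_modular p \<Omega> f \<le> Lp_modular p UNIV f"
    unfolding modular_def using assms(2)
    by (simp add: nn_integral_restrict_space) (intro nn_integral_mono, auto simp: indicator_def)
  with f show ?thesis unfolding Lp_space_iff_modular[OF assms(2)]
    by (auto intro: le_less_trans measurable_restrict_space1)
qed

lemma Lp_space_extend:
  fixes f :: "'a \<Rightarrow> 'b::euclidean_space"
  assumes \<Omega>: "open \<Omega>" and f: "f \<in> Lp_space p \<Omega>" and S: "S \<in> sets lebesgue" "S \<subseteq> \<Omega>"
  shows "(\<lambda>x. if x \<in> S then f x else 0) \<in> Lp_space p UNIV"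
proof -
  have \<Omega>m: "\<Omega> \<in> sets lebesgue" using \<Omega> by simp
  have fm: "f \<in> borel_measurable (lebesgue_on \<Omega>)" and fin: "Lp_modular p \<Omega> f < \<infinity>"
    using f unfolding Lp_space_iff_modular[OF \<Omega>] by auto
  have "(\<lambda>x. indicator \<Omega> x *\<^sub>R f x) \<in> borel_measurable lebesgue"
    using fm \<Omega>m by (simp add: borel_measurable_restrict_space_iff)
  then have "(\<lambda>x. indicator S x *\<^sub>R (indicator \<Omega> x *\<^sub>R f x)) \<in> borel_measurable lebesgue"
    using S(1) by measurable
  also have "(\<lambda>x. indicator S x *\<^sub>R (indicator \<Omega> x *\<^sub>R f x)) = (\<lambda>x. if x \<in> S then f x else 0)"
    using S(2) by (auto simp: indicator_def fun_eq_iff)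
  finally have m: "(\<lambda>x. if x \<in> S then f x else 0) \<in> borel_measurable lebesgue" .
  have "Lp_modular p UNIV (\<lambda>x. if x \<in> S then f x else 0) \<le> Lp_modular p \<Omega> f"
    unfolding modular_def using \<Omega>m S(2)
    by (simp add: nn_integral_restrict_space) (intro nn_integral_mono, auto simp: indicator_def)
  with m fin show ?thesis unfolding Lp_space_iff_modular[OF open_UNIV]
    by (auto intro: le_less_trans)
qed

text \<open>\<open>weak_gradient\<close> is an arbitrary choice that cannot be computed with.
  Uniqueness replaces it by any explicit weak gradient, and the two comparisons of norm and modular
  replace the norm by integrals.\<close>

lemma W1p_0_iff_modular:
  assumes \<Omega>: "open \<Omega>"
  shows "u \<in> W1p_0 p \<Omega> \<longleftrightarrow> u \<in> W1p p \<Omega> \<and> (\<forall>\<epsilon>>0. \<exists>v\<in>W1p p UNIV. compact_support_in v \<Omega> \<and>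
    (\<exists>g\<in>Lp_space p \<Omega>. is_weak_gradient \<Omega> (\<lambda>x. u x - v x) g \<and>
      Lp_modular p \<Omega> (\<lambda>x. u x - v x) < ennreal \<epsilon> \<and> Lp_modular p \<Omega> g < ennreal \<epsilon>))"
    (is "_ \<longleftrightarrow> _ \<and> (\<forall>\<epsilon>>0. ?R \<epsilon>)")
proof -
  have diff: "(\<lambda>x. u x - v x) \<in> Lp_space p \<Omega> \<and> (\<exists>g\<in>Lp_space p \<Omega>. is_weak_gradient \<Omega> (\<lambda>x. u x - v x) g)"
    if u: "u \<in> W1p p \<Omega>" and v: "v \<in> W1p p UNIV" for v
  proof -
    obtain g h where g: "u \<in> Lp_space p \<Omega>" "is_weak_gradient \<Omega> u g" "g \<in> Lp_space p \<Omega>"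
      and h: "v \<in> Lp_space p UNIV" "is_weak_gradient UNIV v h" "h \<in> Lp_space p UNIV"
      using u v by (auto simp: W1p_def)
    have "is_weak_gradient \<Omega> (\<lambda>x. u x - v x) (\<lambda>x. g x - h x)"
      by (rule is_weak_gradient_diff[OF g(2) is_weak_gradient_subset[OF h(2)]]) simp
    moreover have "(\<lambda>x. u x - v x) \<in> Lp_space p \<Omega>" "(\<lambda>x. g x - h x) \<in> Lp_space p \<Omega>"
      by (intro Lp_space_diff[OF \<Omega>] Lp_space_subset[OF _ \<Omega>] g h)+
    ultimately show ?thesis by blast
  qed
  have wg: "Lp_norm p \<Omega> (weak_gradient \<Omega> w) = Lp_norm p \<Omega> g" if g: "is_weak_gradient \<Omega> w g" for w g
  proof (rule Lp_norm_cong_AE[OF \<Omega>])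
    have "is_weak_gradient \<Omega> w (weak_gradient \<Omega> w)"
      unfolding weak_gradient_def by (rule someI[of "is_weak_gradient \<Omega> w", OF g])
    from weak_gradient_unique[OF \<Omega> this g]
    show "AE x in lebesgue_on \<Omega>. weak_gradient \<Omega> w x = g x"
      unfolding AE_lebesgue_on_open[OF \<Omega>] .
  qed
  have "?R \<epsilon>" if u: "u \<in> W1p_0 p \<Omega>" and \<epsilon>: "\<epsilon> > 0" for \<epsilon> :: real
  proof -
    define \<delta> where "\<delta> = min 1 (\<epsilon> / 2)"
    have \<delta>: "\<delta> > 0" "\<delta> \<le> 1" "\<delta> < \<epsilon>" using \<epsilon> by (auto simp: \<delta>_def min_def)
    obtain v where v: "v \<in> W1p p UNIV" "compact_support_in v \<Omega>" "W1p_norm p \<Omega> (\<lambda>x. u x - v x) < ennreal \<delta>"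
      using u \<delta>(1) unfolding W1p_0_def by blast
    obtain g where g: "g \<in> Lp_space p \<Omega>" "is_weak_gradient \<Omega> (\<lambda>x. u x - v x) g"
      and uv: "(\<lambda>x. u x - v x) \<in> Lp_space p \<Omega>"
      using diff[OF _ v(1)] u by (auto simp: W1p_0_def)
    have le: "Lp_norm p \<Omega> (\<lambda>x. u x - v x) < ennreal \<delta>" "Lp_norm p \<Omega> g < ennreal \<delta>"
      using v(3) unfolding W1p_norm_def wg[OF g(2)]
      by (auto intro: le_less_trans[rotated])
    have "Lp_modular p \<Omega> (\<lambda>x. u x - v x) \<le> ennreal \<delta>" "Lp_modular p \<Omega> g \<le> ennreal \<delta>"
      using uv g(1) by (auto intro!: modular_le_of_Lp_norm_less[OF \<Omega> _ _ \<delta>(2)] le simp: Lp_space_def)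
    moreover have "ennreal \<delta> < ennreal \<epsilon>" using \<delta> by (simp add: ennreal_less_iff)
    ultimately have "Lp_modular p \<Omega> (\<lambda>x. u x - v x) < ennreal \<epsilon>" "Lp_modular p \<Omega> g < ennreal \<epsilon>"
      by (auto intro: le_less_trans)
    with v g show ?thesis by blast
  qed
  moreover have "u \<in> W1p_0 p \<Omega>" if u: "u \<in> W1p p \<Omega>" and R: "\<forall>\<epsilon>>0. ?R \<epsilon>"
    unfolding W1p_0_def
  proof (intro CollectI conjI u allI impI)
    fix \<epsilon> :: real assume \<epsilon>: "\<epsilon> > 0"
    \<comment> \<open>Two norms of size at most \<delta> must add up to less than \<epsilon>, and
      the comparison requires \<delta> \<le> 1; \<open>\<delta> powr P\<close> is the modular
      threshold belonging to norm \<delta>.\<close>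
    define \<delta> where "\<delta> = min 1 (\<epsilon> / 3)"
    have \<delta>: "\<delta> > 0" "\<delta> \<le> 1" "\<delta> + \<delta> < \<epsilon>" using \<epsilon> by (auto simp: \<delta>_def min_def)
    obtain v g where v: "v \<in> W1p p UNIV" "compact_support_in v \<Omega>" and g: "g \<in> Lp_space p \<Omega>"
      "is_weak_gradient \<Omega> (\<lambda>x. u x - v x) g" "Lp_modular p \<Omega> (\<lambda>x. u x - v x) < ennreal (\<delta> powr P)"
      "Lp_modular p \<Omega> g < ennreal (\<delta> powr P)"
      using R[rule_format, of "\<delta> powr P"] \<delta>(1) by auto
    have "W1p_norm p \<Omega> (\<lambda>x. u x - v x) \<le> ennreal \<delta> + ennreal \<delta>"
      unfolding W1p_norm_def wg[OF g(2)] using diff[OF u v(1)] g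
      by (intro add_mono Lp_norm_le_of_modular_le[OF \<Omega> _ _ \<delta>(1,2)] less_imp_le[OF g(3)] less_imp_le[OF g(4)])
        (auto simp: Lp_space_def)
    also have "\<dots> < ennreal \<epsilon>" using \<delta> by (simp add: ennreal_less_iff flip: ennreal_plus)
    finally show "\<exists>v\<in>W1p p UNIV. compact_support_in v \<Omega> \<and> W1p_norm p \<Omega> (\<lambda>x. u x - v x) < ennreal \<epsilon>"
      using v by blast
  qed
  ultimately show ?thesis by (auto simp: W1p_0_def)
qed

end

subsection \<open>Sandwiched functions\<close>

text \<open>Where a < 0, convergence to a forces b \<le> 0 eventually; where a = 0, g vanishes. So
  the integrand tends to 0 and is dominated by |g|^q. Convergence in the modular is pointwise only
  along a subsequence, hence r.\<close>

lemma (in bounded_exponent) modular_indicator_tendsto_0: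
  fixes a :: "'a \<Rightarrow> real" and b :: "nat \<Rightarrow> 'a \<Rightarrow> real" and g :: "'a \<Rightarrow> 'b::euclidean_space"
  assumes [measurable]: "a \<in> borel_measurable M" "\<And>n. b n \<in> borel_measurable M" "g \<in> borel_measurable M"
    and a: "AE x in M. a x \<le> 0" "AE x in M. a x = 0 \<longrightarrow> g x = 0"
    and g: "modular M q g < \<infinity>"
    and lim: "(\<lambda>n. modular M q (\<lambda>x. b n x - a x)) \<longlonglongrightarrow> 0" and fin: "\<And>n. modular M q (\<lambda>x. b n x - a x) < \<infinity>"
  obtains r where "strict_mono r" "(\<lambda>n. modular M q (\<lambda>x. if b (r n) x > 0 then g x else 0)) \<longlonglongrightarrow> 0"
proof -
  let ?y = "\<lambda>n x. norm (b n x - a x) powr q x"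
  have eq: "(LINT x|M. norm (?y n x)) = enn2real (modular M q (\<lambda>x. b n x - a x))" for n
    unfolding modular_def by (subst integral_eq_nn_integral) auto
  have int: "integrable M (?y n)" for n
    using fin[of n] unfolding modular_def by (intro integrableI_bounded) auto
  have "(\<lambda>n. LINT x|M. norm (?y n x)) \<longlonglongrightarrow> 0"
    unfolding eq using tendsto_enn2real[of _ 0] lim by simp
  with tendsto_L1_AE_subseq[of M ?y] int obtain r where r: "strict_mono r"
    and AE: "AE x in M. (\<lambda>n. ?y (r n) x) \<longlonglongrightarrow> 0"
    by blast
  have "(\<lambda>n. \<integral>\<^sup>+x. ennreal (norm (if b (r n) x > 0 then g x else 0) powr q x) \<partial>M) \<longlonglongrightarrow> (\<integral>\<^sup>+x. 0 \<partial>M)"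
  proof (rule nn_integral_dominated_convergence[where w="\<lambda>x. ennreal (norm (g x) powr q x)"])
    show "(\<integral>\<^sup>+x. ennreal (norm (g x) powr q x) \<partial>M) < \<infinity>"
      using g by (simp add: modular_def)
    show "AE x in M. ennreal (norm (if b (r n) x > 0 then g x else 0) powr q x) \<le> ennreal (norm (g x) powr q x)" for n
      by auto
    show "AE x in M. (\<lambda>n. ennreal (norm (if b (r n) x > 0 then g x else 0) powr q x)) \<longlonglongrightarrow> 0"
      using AE a exponent_bounds
    proof eventually_elim
      case (elim x)
      show ?case
      proof (cases "a x = 0")
        case True
        then show ?thesis using elim(3) by (simp cong: if_cong)
      next
        case False
        then have ax: "a x < 0" using elim(2) by simp
        then have "\<forall>\<^sub>F n in sequentially. ?y (r n) x < \<bar>a x\<bar> powr q x"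
          using elim(1) by (intro order_tendstoD(2)[OF elim(1)]) simp
        then have "\<forall>\<^sub>F n in sequentially. ennreal (norm (if b (r n) x > 0 then g x else 0) powr q x) = 0"
        proof eventually_elim
          case (elim n)
          have "\<not> b (r n) x > 0"
          proof
            assume "b (r n) x > 0"
            \<comment> \<open>As b > 0 > a, the distance |b - a| is at least |a|. Comparing the
              powers themselves avoids extracting roots from the convergence of
              \<open>?y\<close>.\<close>
            then have "\<bar>a x\<bar> powr q x \<le> norm (b (r n) x - a x) powr q x"
              using ax \<open>1 \<le> q x \<and> q x \<le> P\<close> by (intro powr_mono2) auto
            with elim show False by simp
          qed
          then show ?case by simp
        qed
        then show ?thesis by (rule tendsto_eventually)
      qed
    qed
  qed measurable
  with r show ?thesis using that unfolding modular_def by simp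
qed

context variable_exponent
begin

text \<open>If \<open>v\<^sub>1\<close>, \<open>v\<^sub>2\<close> approximate \<open>u\<^sub>1\<close>, \<open>u\<^sub>2\<close> and \<open>S\<close> contains the supports of \<open>v\<^sub>1\<close> and \<open>v\<^sub>2\<close>, then
  \<open>u - (u\<^sub>1 - v\<^sub>1) - max 0 b\<close> with \<open>b = (u - u\<^sub>1) - (v\<^sub>2 - v\<^sub>1)\<close> vanishes off \<open>S\<close>, because
  \<open>b = u - u\<^sub>1 \<ge> 0\<close> there.\<close>

lemma sandwich_approximant:
  fixes u u1 v1 v2 :: "'a \<Rightarrow> real"
  defines "b \<equiv> \<lambda>x. (u x - v2 x) - (u1 x - v1 x)"
  assumes \<Omega>: "open \<Omega>"
    and u: "u \<in> Lp_space p \<Omega>" "is_weak_gradient \<Omega> u gu" "gu \<in> Lp_space p \<Omega>"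
    and w1: "(\<lambda>x. u1 x - v1 x) \<in> Lp_space p \<Omega>" "is_weak_gradient \<Omega> (\<lambda>x. u1 x - v1 x) g1" "g1 \<in> Lp_space p \<Omega>"
    and b: "b \<in> Lp_space p \<Omega>" "is_weak_gradient \<Omega> b gb" "gb \<in> Lp_space p \<Omega>"
    and v: "compact_support_in v1 \<Omega>" "compact_support_in v2 \<Omega>"
    and le: "AE x in lebesgue_on \<Omega>. u1 x \<le> u x"
  obtains V where "V \<in> W1p p UNIV" "compact_support_in V \<Omega>"
    "AE x in lebesgue_on \<Omega>. u x - V x = (u1 x - v1 x) + max 0 (b x)"
    "is_weak_gradient \<Omega> (\<lambda>x. u x - V x) (\<lambda>x. g1 x + (if b x > 0 then gb x else 0))"
    "(\<lambda>x. g1 x + (if b x > 0 then gb x else 0)) \<in> Lp_space p \<Omega>"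
proof -
  define S where "S = closure {x. v1 x \<noteq> 0} \<union> closure {x. v2 x \<noteq> 0}"
  have S: "compact S" "S \<subseteq> \<Omega>" using v by (auto simp: S_def compact_support_in_def)
  have off: "v1 x = 0" "v2 x = 0" if "x \<notin> S" for x
    using that closure_subset[of "{x. v1 x \<noteq> 0}"] closure_subset[of "{x. v2 x \<noteq> 0}"] by (auto simp: S_def)
  have Sm: "S \<in> sets lebesgue" by (rule fmeasurableD[OF lmeasurable_compact[OF S(1)]])
  define gB where "gB x = (if b x > 0 then gb x else 0)" for x
  have [measurable]: "b \<in> borel_measurable (lebesgue_on \<Omega>)" "gb \<in> borel_measurable (lebesgue_on \<Omega>)"
    using b by (auto simp: Lp_space_def)
  have B: "(\<lambda>x. max 0 (b x)) \<in> Lp_space p \<Omega>"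
    by (rule Lp_space_bound[OF \<Omega> b(1)]) auto
  have gB: "gB \<in> Lp_space p \<Omega>"
    unfolding gB_def[abs_def] by (rule Lp_space_bound[OF \<Omega> b(3)]) auto
  have wB: "is_weak_gradient \<Omega> (\<lambda>x. max 0 (b x)) gB"
    unfolding gB_def[abs_def] by (rule is_weak_gradient_max_0[OF \<Omega> b(2)])
  \<comment> \<open>Pointwise this is \<open>v1 + min (u - u1) (v2 - v1)\<close>, in the form from
    which its weak gradient can be read off.\<close>
  define f where "f x = u x - (u1 x - v1 x) - max 0 (b x)" for x
  define gf where "gf x = gu x - g1 x - gB x" for x
  have f: "f \<in> Lp_space p \<Omega>" "gf \<in> Lp_space p \<Omega>" "is_weak_gradient \<Omega> f gf"
    unfolding f_def[abs_def] gf_def[abs_def]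
    by (rule Lp_space_diff[OF \<Omega> Lp_space_diff[OF \<Omega> u(1) w1(1)] B]
          Lp_space_diff[OF \<Omega> Lp_space_diff[OF \<Omega> u(3) w1(3)] gB]
          is_weak_gradient_diff[OF is_weak_gradient_diff[OF u(2) w1(2)] wB])+
  have f0: "AE x in lebesgue. x \<in> \<Omega> \<longrightarrow> x \<notin> S \<longrightarrow> f x = 0"
    using le unfolding AE_lebesgue_on_open[OF \<Omega>]
    by eventually_elim (auto simp: f_def b_def off)
  \<comment> \<open>On \<Omega>, f vanishes off S only almost everywhere, and outside \<Omega> its
    values are arbitrary. Setting it to 0 makes the support condition hold, which concerns every
    point.\<close>
  define V where "V x = (if x \<in> S then f x else 0)" for x
  have wV: "is_weak_gradient UNIV V (\<lambda>x. if x \<in> S then gf x else 0)"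
    unfolding V_def[abs_def] by (rule is_weak_gradient_extend[OF \<Omega> f(3) S f0])
  have "V \<in> Lp_space p UNIV" "(\<lambda>x. if x \<in> S then gf x else 0) \<in> Lp_space p UNIV"
    unfolding V_def[abs_def] by (intro Lp_space_extend[OF \<Omega> _ Sm S(2)] f)+
  with wV have VW: "V \<in> W1p p UNIV" by (auto simp: W1p_def)
  have Vsub: "closure {x. V x \<noteq> 0} \<subseteq> S"
    using S(1) by (intro closure_minimal compact_imp_closed) (auto simp: V_def)
  then have "compact (closure {x. V x \<noteq> 0})"
    by (metis Int_absorb1 compact_Int_closed S(1) closed_closure)
  with Vsub S(2) have Vs: "compact_support_in V \<Omega>" by (auto simp: compact_support_in_def)
  have AE: "AE x in lebesgue. x \<in> \<Omega> \<longrightarrow> (u1 x - v1 x) + max 0 (b x) = u x - V x"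
    using f0 by eventually_elim (auto simp: V_def f_def)
  have "is_weak_gradient \<Omega> (\<lambda>x. u x - V x) (\<lambda>x. g1 x + gB x)"
  proof (rule is_weak_gradient_cong_AE[OF is_weak_gradient_add[OF w1(2) wB] _ AE])
    show "locally_integrable \<Omega> (\<lambda>x. u x - V x)"
      by (intro locally_integrable_diff is_weak_gradientD(1)[OF u(2)]
          locally_integrable_mono[OF is_weak_gradientD(1)[OF wV]]) simp
  qed
  moreover have "(\<lambda>x. g1 x + gB x) \<in> Lp_space p \<Omega>"
    by (rule Lp_space_add[OF \<Omega> w1(3) gB])
  moreover have "AE x in lebesgue_on \<Omega>. u x - V x = (u1 x - v1 x) + max 0 (b x)"
    unfolding AE_lebesgue_on_open[OF \<Omega>] using AE by eventually_elim auto
  ultimately show ?thesis using that VW Vs unfolding gB_def[abs_def] by blast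
qed

text \<open>The distance from u to its approximant consists of the error of \<open>v1\<close> and
  the positive part of b. The latter is at most |b - a| because a \<le> 0; its gradient is that of a
  on \<open>{b > 0}\<close> up to errors, the case of
  \<open>modular_indicator_tendsto_0\<close>.\<close>

lemma W1p_0_sandwich:
  fixes u u1 u2 :: "'a \<Rightarrow> real"
  assumes \<Omega>: "open \<Omega>" and u: "u \<in> W1p p \<Omega>"
    and u1: "u1 \<in> W1p_0 p \<Omega>" and u2: "u2 \<in> W1p_0 p \<Omega>"
    and le: "AE x in lebesgue_on \<Omega>. u1 x \<le> u x \<and> u x \<le> u2 x"
  shows "u \<in> W1p_0 p \<Omega>"
  unfolding W1p_0_iff_modular[OF \<Omega>]
proof (intro conjI u allI impI)
  interpret bounded_exponent "lebesgue_on \<Omega>" "\<lambda>x. real_of_ereal (p x)" P by (rule bounded[OF \<Omega>])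
  let ?m = "\<lambda>f. Lp_modular p \<Omega> f"
  define e where "e n = ennreal (1 / real (Suc n))" for n
  have e0: "e \<longlonglongrightarrow> 0"
    unfolding e_def using tendsto_ennrealI[OF LIMSEQ_Suc[OF lim_1_over_n[where 'a=real]]] by simp
  have efin: "e n < \<infinity>" for n by (simp add: e_def)
  have appr: "\<exists>v g. \<forall>n. v n \<in> W1p p UNIV \<and> compact_support_in (v n) \<Omega> \<and> g n \<in> Lp_space p \<Omega> \<and>
      is_weak_gradient \<Omega> (\<lambda>x. w x - v n x) (g n) \<and> ?m (\<lambda>x. w x - v n x) < e n \<and> ?m (g n) < e n"
    if w: "w \<in> W1p_0 p \<Omega>" for w
  proof -
    have "\<exists>v g. v \<in> W1p p UNIV \<and> compact_support_in v \<Omega> \<and> g \<in> Lp_space p \<Omega> \<and>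
      is_weak_gradient \<Omega> (\<lambda>x. w x - v x) g \<and> ?m (\<lambda>x. w x - v x) < e n \<and> ?m g < e n" for n
    proof -
      have "1 / real (Suc n) > 0" by simp
      then show ?thesis
        using w unfolding W1p_0_iff_modular[OF \<Omega>] e_def by blast
    qed
    then have "\<forall>n. \<exists>v g. v \<in> W1p p UNIV \<and> compact_support_in v \<Omega> \<and> g \<in> Lp_space p \<Omega> \<and>
      is_weak_gradient \<Omega> (\<lambda>x. w x - v x) g \<and> ?m (\<lambda>x. w x - v x) < e n \<and> ?m g < e n" ..
    then show ?thesis unfolding choice_iff .
  qed
  obtain v1 g1 where v1: "\<And>n. v1 n \<in> W1p p UNIV" "\<And>n. compact_support_in (v1 n) \<Omega>" "\<And>n. g1 n \<in> Lp_space p \<Omega>"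
      "\<And>n. is_weak_gradient \<Omega> (\<lambda>x. u1 x - v1 n x) (g1 n)" "\<And>n. ?m (\<lambda>x. u1 x - v1 n x) < e n" "\<And>n. ?m (g1 n) < e n"
    using appr[OF u1] by blast
  obtain v2 g2 where v2: "\<And>n. v2 n \<in> W1p p UNIV" "\<And>n. compact_support_in (v2 n) \<Omega>" "\<And>n. g2 n \<in> Lp_space p \<Omega>"
      "\<And>n. is_weak_gradient \<Omega> (\<lambda>x. u2 x - v2 n x) (g2 n)" "\<And>n. ?m (\<lambda>x. u2 x - v2 n x) < e n" "\<And>n. ?m (g2 n) < e n"
    using appr[OF u2] by blast
  obtain gu h2 where gu: "u \<in> Lp_space p \<Omega>" "is_weak_gradient \<Omega> u gu" "gu \<in> Lp_space p \<Omega>"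
      and h2: "u2 \<in> Lp_space p \<Omega>" "is_weak_gradient \<Omega> u2 h2" "h2 \<in> Lp_space p \<Omega>"
    using u u2 by (auto simp: W1p_def W1p_0_def)
  have u1L: "u1 \<in> Lp_space p \<Omega>" using u1 by (auto simp: W1p_def W1p_0_def)
  have v1L: "v1 n \<in> Lp_space p \<Omega>" and v2L: "v2 n \<in> Lp_space p \<Omega>" for n
    using v1(1)[of n] v2(1)[of n] by (auto simp: W1p_def intro!: Lp_space_subset[OF _ \<Omega>])
  define a where "a x = u x - u2 x" for x
  define ga where "ga x = gu x - h2 x" for x
  have a: "a \<in> Lp_space p \<Omega>" "is_weak_gradient \<Omega> a ga" "ga \<in> Lp_space p \<Omega>"
    unfolding a_def[abs_def] ga_def[abs_def]
    by (intro Lp_space_diff[OF \<Omega>] is_weak_gradient_diff gu h2)+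
  \<comment> \<open>The errors of \<open>v1 n\<close> and \<open>v2 n\<close> enter additively, so
    \<open>b n\<close> and \<open>gb n\<close> differ from a and \<open>ga\<close> by functions of
    small modular.\<close>
  define b where "b n x = (u x - v2 n x) - (u1 x - v1 n x)" for n x
  define gb where "gb n x = ga x + (g2 n x - g1 n x)" for n x
  have w1L: "(\<lambda>x. u1 x - v1 n x) \<in> Lp_space p \<Omega>" and w2L: "(\<lambda>x. u2 x - v2 n x) \<in> Lp_space p \<Omega>" for n
    by (intro Lp_space_diff[OF \<Omega>] u1L v1L v2L h2)+
  have b_eq: "b n = (\<lambda>x. a x + ((u2 x - v2 n x) - (u1 x - v1 n x)))" for n
    by (auto simp: b_def a_def)
  have b: "b n \<in> Lp_space p \<Omega>" "is_weak_gradient \<Omega> (b n) (gb n)" "gb n \<in> Lp_space p \<Omega>" for n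
    unfolding b_eq gb_def[abs_def]
    by (intro Lp_space_add[OF \<Omega>] Lp_space_diff[OF \<Omega>] is_weak_gradient_add is_weak_gradient_diff
        a v1 v2 w1L w2L)+
  have meas: "f \<in> borel_measurable (lebesgue_on \<Omega>)" if "f \<in> Lp_space p \<Omega>" for f :: "'a \<Rightarrow> 'b::euclidean_space"
    using that by (simp add: Lp_space_def)
  note [measurable] = meas[OF a(1)] meas[OF a(3)] meas[OF b(1)] meas[OF b(3)] meas[OF v1(3)] meas[OF v2(3)]
    meas[OF w1L] meas[OF w2L]
  define C where "C = ennreal (2 powr P)"
  have Cfin: "C < \<infinity>" by (simp add: C_def)
  have ba: "?m (\<lambda>x. b n x - a x) \<le> C * (e n + e n)" for n
  proof -
    have "?m (\<lambda>x. b n x - a x) = ?m (\<lambda>x. (u2 x - v2 n x) - (u1 x - v1 n x))"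
      by (simp add: b_eq)
    also have "\<dots> \<le> C * (?m (\<lambda>x. u2 x - v2 n x) + ?m (\<lambda>x. u1 x - v1 n x))"
      unfolding C_def by (rule modular_diff) measurable
    also have "\<dots> \<le> C * (e n + e n)"
      by (intro mult_left_mono add_mono less_imp_le[OF v1(5)] less_imp_le[OF v2(5)]) auto
    finally show ?thesis .
  qed
  have lim_ee: "(\<lambda>n. C * (e n + e n)) \<longlonglongrightarrow> 0"
    using ennreal_tendsto_cmult[OF _ tendsto_add[OF e0 e0], of C] Cfin by simp
  have lim: "(\<lambda>n. ?m (\<lambda>x. b n x - a x)) \<longlonglongrightarrow> 0"
    by (rule tendsto_sandwich[OF _ _ tendsto_const lim_ee]) (use ba in auto)
  have fin: "?m (\<lambda>x. b n x - a x) < \<infinity>" for n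
    using efin[of n] Cfin by (intro le_less_trans[OF ba]) (simp add: ennreal_mult_less_top)
  have a_le: "AE x in lebesgue_on \<Omega>. a x \<le> 0"
    using le by eventually_elim (simp add: a_def)
  have a_0: "AE x in lebesgue_on \<Omega>. a x = 0 \<longrightarrow> ga x = 0"
    unfolding AE_lebesgue_on_open[OF \<Omega>] by (rule weak_gradient_zero_level[OF \<Omega> a(2)])
  obtain r where r: "strict_mono r"
    and lim_r: "(\<lambda>n. ?m (\<lambda>x. if b (r n) x > 0 then ga x else 0)) \<longlonglongrightarrow> 0"
  proof (rule modular_indicator_tendsto_0[of a b ga])
    show "?m ga < \<infinity>" using a(3) by (simp add: Lp_space_iff_modular[OF \<Omega>])
  qed (use a_le a_0 lim fin in auto)
  let ?d = "\<lambda>n. ?m (\<lambda>x. if b (r n) x > 0 then ga x else 0)"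
  have er: "(\<lambda>n. e (r n)) \<longlonglongrightarrow> 0" using LIMSEQ_subseq_LIMSEQ[OF e0 r] by (simp add: comp_def)
  \<comment> \<open>This sequence and the next are the final bounds for the modulars of u - V and of
    its gradient; each use of \<open>modular_add\<close> or \<open>modular_diff\<close> costs one
    factor C.\<close>
  have lim1: "(\<lambda>n. C * (e (r n) + C * (e (r n) + e (r n)))) \<longlonglongrightarrow> 0"
    using ennreal_tendsto_cmult[OF _ tendsto_add[OF er LIMSEQ_subseq_LIMSEQ[OF lim_ee r]], of C] Cfin
    by (simp add: comp_def)
  have lim2: "(\<lambda>n. C * (e (r n) + C * (?d n + C * (e (r n) + e (r n))))) \<longlonglongrightarrow> 0"
    using ennreal_tendsto_cmult[OF _ tendsto_add[OF er ennreal_tendsto_cmult[OF _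
            tendsto_add[OF lim_r LIMSEQ_subseq_LIMSEQ[OF lim_ee r]], of C]], of C] Cfin
    by (simp add: comp_def)
  fix \<epsilon> :: real assume "\<epsilon> > 0"
  then have \<epsilon>: "0 < ennreal \<epsilon>" by simp
  have "\<forall>\<^sub>F n in sequentially. C * (e (r n) + C * (e (r n) + e (r n))) < ennreal \<epsilon> \<and>
      C * (e (r n) + C * (?d n + C * (e (r n) + e (r n)))) < ennreal \<epsilon>"
    by (intro eventually_conj order_tendstoD(2)[OF lim1 \<epsilon>] order_tendstoD(2)[OF lim2 \<epsilon>])
  then obtain n where n: "C * (e (r n) + C * (e (r n) + e (r n))) < ennreal \<epsilon>"
      "C * (e (r n) + C * (?d n + C * (e (r n) + e (r n)))) < ennreal \<epsilon>"
    using eventually_happens'[OF sequentially_bot] by blast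
  define k where "k = r n"
  obtain V where V: "V \<in> W1p p UNIV" "compact_support_in V \<Omega>"
    "AE x in lebesgue_on \<Omega>. u x - V x = (u1 x - v1 k x) + max 0 (b k x)"
    "is_weak_gradient \<Omega> (\<lambda>x. u x - V x) (\<lambda>x. g1 k x + (if b k x > 0 then gb k x else 0))"
    "(\<lambda>x. g1 k x + (if b k x > 0 then gb k x else 0)) \<in> Lp_space p \<Omega>"
  proof (rule sandwich_approximant[of \<Omega> u gu u1 "v1 k" "g1 k" "v2 k" "gb k"])
    show "AE x in lebesgue_on \<Omega>. u1 x \<le> u x" using le by eventually_elim simp
  qed (use \<Omega> gu w1L v1 v2 b[of k] in \<open>auto simp: b_def[abs_def]\<close>)
  have "?m (\<lambda>x. u x - V x) = ?m (\<lambda>x. (u1 x - v1 k x) + max 0 (b k x))"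
    by (rule modular_cong_AE[OF V(3)])
  also have "\<dots> \<le> C * (?m (\<lambda>x. u1 x - v1 k x) + ?m (\<lambda>x. max 0 (b k x)))"
    unfolding C_def by (rule modular_add) measurable
  also have "\<dots> \<le> C * (e k + C * (e k + e k))"
  proof (intro mult_left_mono add_mono less_imp_le[OF v1(5)])
    \<comment> \<open>Since a \<le> 0, the positive part of b is at most |b - a|.\<close>
    have "?m (\<lambda>x. max 0 (b k x)) \<le> ?m (\<lambda>x. b k x - a x)"
      by (rule modular_mono_AE) (use a_le in \<open>eventually_elim, auto\<close>)
    also note ba
    finally show "?m (\<lambda>x. max 0 (b k x)) \<le> C * (e k + e k)" .
  qed auto
  also have "\<dots> < ennreal \<epsilon>" using n(1) by (simp add: k_def)
  finally have m1: "?m (\<lambda>x. u x - V x) < ennreal \<epsilon>" .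
  have "?m (\<lambda>x. g1 k x + (if b k x > 0 then gb k x else 0)) \<le>
      C * (?m (g1 k) + ?m (\<lambda>x. if b k x > 0 then gb k x else 0))"
    unfolding C_def by (rule modular_add) measurable
  also have "\<dots> \<le> C * (e k + C * (?d n + C * (e k + e k)))"
  proof (intro mult_left_mono add_mono less_imp_le[OF v1(6)])
    \<comment> \<open>On \<open>{b > 0}\<close> the term \<open>ga\<close> is small by the choice of
      the subsequence; the term \<open>g2 - g1\<close> is small on all of \<Omega>, so its indicator
      may be dropped.\<close>
    have "?m (\<lambda>x. if b k x > 0 then gb k x else 0) \<le>
        ?m (\<lambda>x. (if b k x > 0 then ga x else 0) + (if b k x > 0 then g2 k x - g1 k x else 0))"
      by (rule modular_mono_AE) (auto simp: gb_def)
    also have "\<dots> \<le> C * (?d n + ?m (\<lambda>x. if b k x > 0 then g2 k x - g1 k x else 0))"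
      unfolding C_def k_def by (rule modular_add) measurable
    also have "\<dots> \<le> C * (?d n + C * (e k + e k))"
    proof (intro mult_left_mono add_mono order_refl)
      have "?m (\<lambda>x. if b k x > 0 then g2 k x - g1 k x else 0) \<le> ?m (\<lambda>x. g2 k x - g1 k x)"
        by (rule modular_mono_AE) auto
      also have "\<dots> \<le> C * (?m (g2 k) + ?m (g1 k))"
        unfolding C_def by (rule modular_diff) measurable
      also have "\<dots> \<le> C * (e k + e k)"
        by (intro mult_left_mono add_mono less_imp_le[OF v1(6)] less_imp_le[OF v2(6)]) auto
      finally show "?m (\<lambda>x. if b k x > 0 then g2 k x - g1 k x else 0) \<le> C * (e k + e k)" .
    qed auto
    finally show "?m (\<lambda>x. if b k x > 0 then gb k x else 0) \<le> C * (?d n + C * (e k + e k))" .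
  qed auto
  also have "\<dots> < ennreal \<epsilon>" using n(2) by (simp add: k_def)
  finally have m2: "?m (\<lambda>x. g1 k x + (if b k x > 0 then gb k x else 0)) < ennreal \<epsilon>" .
  show "\<exists>v\<in>W1p p UNIV. compact_support_in v \<Omega> \<and> (\<exists>g\<in>Lp_space p \<Omega>. is_weak_gradient \<Omega> (\<lambda>x. u x - v x) g \<and>
      Lp_modular p \<Omega> (\<lambda>x. u x - v x) < ennreal \<epsilon> \<and> Lp_modular p \<Omega> g < ennreal \<epsilon>)"
    using V(1,2,4,5) m1 m2 by blast
qed

end

theorem lemma2p6:
  fixes p :: "real ^ 'n \<Rightarrow> ereal"
    and \<Omega> :: "(real ^ 'n) set"
    and u u\<^sub>1 u\<^sub>2 :: "real ^ 'n \<Rightarrow> real"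
  assumes "admissible_exponent p"
    and "open \<Omega>" and "\<Omega> \<noteq> {}"
    and "u \<in> W1p p \<Omega>"
    and "u\<^sub>1 \<in> W1p_0 p \<Omega>" and "u\<^sub>2 \<in> W1p_0 p \<Omega>"
    and "AE x in lebesgue_on \<Omega>. u\<^sub>1 x \<le> u x \<and> u x \<le> u\<^sub>2 x"
  shows "u \<in> W1p_0 p \<Omega>"
proof -
  obtain P where "variable_exponent p P"
    using admissible_exponent_bounded[OF assms(1)] by blast
  from variable_exponent.W1p_0_sandwich[OF this assms(2,4-7)] show ?thesis .
qed

end
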